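(* Define the polynomial sequence $\{w_n(x)\}_{n\ge 0}$ in $\mathbb{Z}[x]$ by $w_0(x)=1$, $w_1(x)=1$ and $w_n(x)=(x-2)w_{n-1}(x)-w_{n-2}(x)$ for $n\ge 2$. For each odd integer $d>1$ define $$\Omega_d(x)=\prod_{\substack{1\le m<d,\ m \text{ odd}\\ \gcd(m,d)=1}}\left(x-\left(e^{i\pi m/d}+e^{-i\pi m/d}+2\right)\right);$$ the irreducible factors of $w_n(x)$ over $\mathbb{Q}$ are the $\Omega_d(x)$ with $d\mid (2n-1)$, $d>1$. Let $n\ge 2$ be such that $2n-1$ satisfies Condition $\mathcal{C}$. Then every irreducible factor $\Omega_d(x)$ of $w_n(x)$ is both monogenic and cyclic. Moreover, if $n_1,n_2\ge 2$ are integers such that $d_1=2n_1-1$ and $d_2=2n_2-1$ both satisfy Condition $\mathcal{C}$ and $d_1\ne d_2$, then $\Omega_{d_1}(x)$ and $\Omega_{d_2}(x)$ are distinct.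
   Context: $\phi$ is Euler's totient function and $C_N$ is the cyclic group of order $N$. A monic polynomial $f(x)\in\mathbb{Z}[x]$ of degree $N$, irreducible over $\mathbb{Q}$, with $f(\theta)=0$, is called monogenic if $\{1,\theta,\theta^2,\ldots,\theta^{N-1}\}$ is a $\mathbb{Z}$-basis for the ring of integers of $\mathbb{Q}(\theta)$; it is called cyclic if its Galois group over $\mathbb{Q}$ is isomorphic to $C_N$. Two monogenic cyclic polynomials $f(x)$ and $g(x)$ of the same degree, with $f(\alpha)=g(\beta)=0$, are called equivalent if $\mathbb{Q}(\alpha)=\mathbb{Q}(\beta)$, and distinct otherwise (monogenic cyclic polynomials of different degrees are never equivalent, hence distinct). An integer $N\ge 2$ satisfies Condition $\mathcal{C}$ if $N\in\{2^a,\ p^a,\ 2p^a,\ 4p^a,\ p^aq^b,\ 2p^aq^b\}$ for some positive integers $a$ and $b$, and distinct odd primes $p$ and $q$ with $\gcd(\phi(p^a),\phi(q^b))=2$ (the gcd requirement being relevant to the forms involving both $p$ and $q$). *)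

theory Defs
  imports
    "HOL-Algebra.Bij"
    "HOL-Algebra.Elementary_Groups"
    "HOL-Algebra.Generated_Fields"
    "HOL-Algebra.Algebraic_Closure_Type"
    "HOL-Number_Theory.Totient"
    "HOL-Computational_Algebra.Computational_Algebra"
    Complex_Main
begin

fun w :: "nat \<Rightarrow> int poly" where
  "w 0 = 1"
| "w (Suc 0) = 1"
| "w (Suc (Suc n)) = [:-2, 1:] * w (Suc n) - w n"

definition Omega :: "nat \<Rightarrow> complex poly" where
  "Omega d = (\<Prod>m | 1 \<le> m \<and> m < d \<and> odd m \<and> coprime m d.
     [:- (exp (\<i> * of_real (pi * real m / real d)) + exp (- (\<i> * of_real (pi * real m / real d))) + 2), 1:])"

definition condition_C :: "nat \<Rightarrow> bool" where
  "condition_C N \<longleftrightarrow> N \<ge> 2 \<and>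
     (\<exists>a b p q. a > 0 \<and> b > 0 \<and> prime p \<and> odd p \<and> prime q \<and> odd q \<and> p \<noteq> q \<and>
        (N \<in> {2 ^ a, p ^ a, 2 * p ^ a, 4 * p ^ a} \<or>
         N \<in> {p ^ a * q ^ b, 2 * p ^ a * q ^ b} \<and>
           gcd (totient (p ^ a)) (totient (q ^ b)) = 2))"

(* All number fields are taken inside the complex numbers.  A subfield generated by a set of
   complex numbers contains the rationals, so this is Q(S). *)
definition Q_adjoin :: "complex set \<Rightarrow> complex set" where
  "Q_adjoin S = generate_field ring_of_type_algebra S"

definition ring_of_integers :: "complex set \<Rightarrow> complex set" where
  "ring_of_integers K = {x \<in> K. algebraic_int x}"

definition is_Z_basis :: "nat \<Rightarrow> (nat \<Rightarrow> complex) \<Rightarrow> complex set \<Rightarrow> bool" where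
  "is_Z_basis N v M \<longleftrightarrow>
     (\<forall>c :: nat \<Rightarrow> int. (\<Sum>i<N. of_int (c i) * v i) = 0 \<longrightarrow> (\<forall>i<N. c i = 0)) \<and>
     range (\<lambda>c :: nat \<Rightarrow> int. \<Sum>i<N. of_int (c i) * v i) = M"

definition monic_irreducible :: "int poly \<Rightarrow> bool" where
  "monic_irreducible f \<longleftrightarrow> lead_coeff f = 1 \<and> irreducible (map_poly of_int f :: rat poly)"

definition complex_roots :: "int poly \<Rightarrow> complex set" where
  "complex_roots f = {\<theta>. poly (map_poly of_int f) \<theta> = 0}"

(* The condition does not depend on the root, since all roots of f are conjugate. *)
definition monogenic :: "int poly \<Rightarrow> bool" where
  "monogenic f \<longleftrightarrow> monic_irreducible f \<and>
     (\<forall>\<theta>\<in>complex_roots f.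
        is_Z_basis (degree f) (\<lambda>i. \<theta> ^ i) (ring_of_integers (Q_adjoin {\<theta>})))"

(* The automorphisms over Q of the splitting field of f in the complex numbers, as a subgroup of
   the group of (extensional) bijections of that field. *)
definition Galois_group :: "int poly \<Rightarrow> (complex \<Rightarrow> complex) monoid" where
  "Galois_group f =
     (let K = Q_adjoin (complex_roots f); R = ring_of_type_algebra\<lparr>carrier := K\<rparr>
      in BijGroup K\<lparr>carrier := {\<sigma> \<in> Bij K. \<sigma> \<in> ring_hom R R \<and> (\<forall>x\<in>\<rat>. \<sigma> x = x)}\<rparr>)"

definition cyclic_poly :: "int poly \<Rightarrow> bool" where
  "cyclic_poly f \<longleftrightarrow> monic_irreducible f \<and> Galois_group f \<cong> integer_mod_group (degree f)"

(* For cyclic polynomials Q(\<alpha>) and Q(\<beta>) are normal over Q, so the choice of roots does not matter;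
   with the existential, non-equivalence excludes every choice. *)
definition equivalent :: "int poly \<Rightarrow> int poly \<Rightarrow> bool" where
  "equivalent f g \<longleftrightarrow> degree f = degree g \<and>
     (\<exists>\<alpha>\<in>complex_roots f. \<exists>\<beta>\<in>complex_roots g. Q_adjoin {\<alpha>} = Q_adjoin {\<beta>})"

abbreviation distinct_polys :: "int poly \<Rightarrow> int poly \<Rightarrow> bool" where
  "distinct_polys f g \<equiv> \<not> equivalent f g"

end

theory Submission
  imports Defs "Jordan_Normal_Form.Char_Poly" "HOL-Number_Theory.Residue_Primitive_Roots"
begin

text \<open>The roots of \<open>\<Omega>\<^sub>d\<close> are the numbers \<open>\<tau>(\<zeta>) = 2 - \<zeta> - \<zeta>\<^sup>-\<^sup>1\<close> with \<open>\<zeta>\<close> a primitive \<open>d\<close>-th root of unity,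
  and they generate the maximal real subfield \<open>K\<close> of \<open>\<rat>(\<zeta>)\<close>. By the Frobenius congruence modulo large
  primes, a rational polynomial that vanishes at \<open>\<zeta>\<close> vanishes at every \<open>\<zeta>\<^sup>k\<close> with \<open>k\<close> coprime to \<open>d\<close>.
  Hence \<open>\<Omega>\<^sub>d\<close> is irreducible, and \<open>\<zeta> \<mapsto> \<zeta>\<^sup>k\<close> identifies the Galois group of \<open>K\<close> with the units modulo \<open>d\<close>
  up to sign, which form a cyclic group under Condition C.

  For monogenicity, \<open>\<int>[\<zeta>]\<close> is shown to be integrally closed one prime at a time: there is an element \<open>a\<close>
  with \<open>a\<close> dividing \<open>p\<close>, \<open>p\<close> dividing a power of \<open>a\<close>, and \<open>\<int>[\<zeta>]\<close> reduced modulo \<open>a\<close>; reducedness allows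
  factors \<open>a\<close> to be cancelled from the denominator of an algebraic integer. Taking imaginary parts
  in \<open>\<int>[\<zeta>] = \<int>[\<tau>] + \<zeta>\<int>[\<tau>]\<close> then shows that the integers of \<open>K\<close> are \<open>\<int>[\<tau>]\<close>.

  If the fields for \<open>d\<^sub>1\<close> and \<open>d\<^sub>2\<close> agree, every unit \<open>k \<equiv> 1\<close> modulo \<open>d\<^sub>1\<close> is \<open>\<plusminus>1\<close> modulo \<open>d\<^sub>2\<close>, and suitable
  choices of \<open>k\<close> force \<open>d\<^sub>1 = d\<^sub>2\<close>.\<close>

section \<open>The ring generated by a root of unity\<close>

lemma power_cong_root_of_unity:
  fixes z :: complex
  assumes "z ^ n = 1" "[i = j] (mod n)"
  shows "z ^ i = z ^ j"
proof -
  have "z ^ k = z ^ (k mod n)" for k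
  proof -
    have "z ^ k = z ^ (n * (k div n) + k mod n)" by simp
    also have "\<dots> = z ^ (k mod n)" unfolding power_add power_mult using assms(1) by simp
    finally show ?thesis .
  qed
  thus ?thesis using assms(2) by (metis cong_def)
qed

definition Z_adjoin :: "complex \<Rightarrow> complex set" where
  "Z_adjoin z = range (\<lambda>A. poly (of_int_poly A) z)"

lemma poly_of_int_poly_pCons [simp]:
  "poly (of_int_poly (pCons a A)) (x::complex) = of_int a + x * poly (of_int_poly A) x"
  by (simp add: of_int_hom.map_poly_pCons_hom)

lemma Z_adjoinI: "x = poly (of_int_poly A) z \<Longrightarrow> x \<in> Z_adjoin z"
  by (auto simp: Z_adjoin_def)

lemma Z_adjoinE:
  assumes "x \<in> Z_adjoin z"
  obtains A where "x = poly (of_int_poly A) z"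
  using assms by (auto simp: Z_adjoin_def)

lemma Z_adjoin_add [intro]: "x \<in> Z_adjoin z \<Longrightarrow> y \<in> Z_adjoin z \<Longrightarrow> x + y \<in> Z_adjoin z"
  by (elim Z_adjoinE, rule Z_adjoinI[of _ "_ + _"]) (auto simp: hom_distribs)

lemma Z_adjoin_diff [intro]: "x \<in> Z_adjoin z \<Longrightarrow> y \<in> Z_adjoin z \<Longrightarrow> x - y \<in> Z_adjoin z"
  by (elim Z_adjoinE, rule Z_adjoinI[of _ "_ - _"]) (auto simp: hom_distribs)

lemma Z_adjoin_mult [intro]: "x \<in> Z_adjoin z \<Longrightarrow> y \<in> Z_adjoin z \<Longrightarrow> x * y \<in> Z_adjoin z"
  by (elim Z_adjoinE, rule Z_adjoinI[of _ "_ * _"]) (auto simp: hom_distribs)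

lemma Z_adjoin_of_int [simp, intro]: "of_int a \<in> Z_adjoin z"
  by (rule Z_adjoinI[of _ "[:a:]"]) simp

lemma Z_adjoin_0 [simp, intro]: "0 \<in> Z_adjoin z"
  and Z_adjoin_1 [simp, intro]: "1 \<in> Z_adjoin z"
  and Z_adjoin_of_nat [simp, intro]: "of_nat n \<in> Z_adjoin z"
  and Z_adjoin_numeral [simp, intro]: "numeral k \<in> Z_adjoin z"
  using Z_adjoin_of_int[of 0] Z_adjoin_of_int[of 1] Z_adjoin_of_int[of "int n"]
    Z_adjoin_of_int[of "numeral k"] by simp_all

lemma Z_adjoin_self [simp, intro]: "z \<in> Z_adjoin z"
  by (rule Z_adjoinI[of _ "[:0, 1:]"]) simp

lemma Z_adjoin_power [intro]: "x \<in> Z_adjoin z \<Longrightarrow> x ^ n \<in> Z_adjoin z"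
  by (induction n) auto

lemma Z_adjoin_uminus [intro]: "x \<in> Z_adjoin z \<Longrightarrow> - x \<in> Z_adjoin z"
  using Z_adjoin_diff[of 0 z x] by simp

lemma Z_adjoin_sum [intro]: "(\<And>i. i \<in> I \<Longrightarrow> f i \<in> Z_adjoin z) \<Longrightarrow> sum f I \<in> Z_adjoin z"
  by (induction I rule: infinite_finite_induct) auto

lemma Z_adjoin_poly [intro]: "x \<in> Z_adjoin z \<Longrightarrow> poly (of_int_poly A) x \<in> Z_adjoin z"
  by (induction A) auto

lemma Z_adjoin_subset: "x \<in> Z_adjoin z \<Longrightarrow> Z_adjoin x \<subseteq> Z_adjoin z"
  by (auto elim!: Z_adjoinE[of _ x])

text \<open>The multiplication by \<open>A(z)\<close> acts on the vector \<open>(1, z, \<dots>, z\<^sup>n\<^sup>-\<^sup>1)\<close> through an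
  integer matrix, of which \<open>A(z)\<close> is thus an eigenvalue.\<close>

lemma algebraic_int_Z_adjoin:
  assumes z: "z ^ n = 1" and n: "n > 0" and x: "x \<in> Z_adjoin z"
  shows "algebraic_int x"
proof -
  obtain A where A: "x = poly (of_int_poly A) z"
    using x by (rule Z_adjoinE)
  \<comment> \<open>Row i writes A(z) z^i in the powers of z, with exponents reduced modulo n
    because z^n = 1.\<close>
  define M :: "int mat" where
    "M = mat n n (\<lambda>(i, j). \<Sum>k\<le>degree A. if (i + k) mod n = j then coeff A k else 0)"
  define v where "v = vec n (\<lambda>i. z ^ i)"
  define N where "N = map_mat (of_int :: int \<Rightarrow> complex) M"
  have M: "M \<in> carrier_mat n n" and N: "N \<in> carrier_mat n n"
    by (auto simp: M_def N_def)
  have z_mod: "z ^ (k mod n) = z ^ k" for k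
    by (rule power_cong_root_of_unity[OF z]) simp
  have "N *\<^sub>v v = x \<cdot>\<^sub>v v"
  proof (rule eq_vecI)
    fix i assume i: "i < dim_vec (x \<cdot>\<^sub>v v)"
    hence i: "i < n" by (simp add: v_def)
    have "(N *\<^sub>v v) $ i =
      (\<Sum>j<n. (\<Sum>k\<le>degree A. if (i + k) mod n = j then of_int (coeff A k) else 0) * z ^ j)"
      using i by (auto simp: N_def M_def v_def scalar_prod_def lessThan_atLeast0 of_int_sum if_distrib[of of_int]
          intro!: sum.cong cong: if_cong)
    also have "\<dots> = (\<Sum>k\<le>degree A. \<Sum>j<n. if (i + k) mod n = j then of_int (coeff A k) * z ^ j else 0)"
      by (subst sum.swap) (auto simp: sum_distrib_right intro!: sum.cong)
    also have "\<dots> = (\<Sum>k\<le>degree A. of_int (coeff A k) * z ^ ((i + k) mod n))"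
      using n by (intro sum.cong refl) (subst sum.delta', auto)
    also have "\<dots> = x * z ^ i"
      unfolding z_mod by (simp add: A poly_altdef sum_distrib_left sum_distrib_right power_add mult_ac)
    finally show "(N *\<^sub>v v) $ i = (x \<cdot>\<^sub>v v) $ i"
      using i by (simp add: v_def)
  qed (use N in \<open>auto simp: v_def\<close>)
  moreover have "v \<noteq> 0\<^sub>v n"
  proof
    assume "v = 0\<^sub>v n"
    hence "v $ 0 = 0" using n by simp
    thus False using n by (simp add: v_def)
  qed
  ultimately have "eigenvalue N x"
    using N unfolding eigenvalue_def eigenvector_def by (intro exI[of _ v]) (simp add: v_def)
  hence "poly (char_poly N) x = 0"
    using eigenvalue_root_char_poly[OF N] by simp
  hence "poly (of_int_poly (char_poly M)) x = 0"
    unfolding N_def of_int_hom.char_poly_hom[OF M] .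
  moreover have "lead_coeff (char_poly M) = 1"
    using degree_monic_char_poly[OF M] by simp
  ultimately show ?thesis
    unfolding algebraic_int_altdef_ipoly by blast
qed

section \<open>Finitely many primes divide a given nonzero element of \<int>[z]\<close>

lemma Z_adjoin_Rats_imp_Ints:
  assumes "z ^ n = 1" "n > 0" "x \<in> Z_adjoin z" "x \<in> \<rat>"
  shows "x \<in> \<int>"
  using algebraic_int_Z_adjoin[OF assms(1-3)] assms(4) by (rule rational_algebraic_int_is_int)

text \<open>Factors x are stripped from the integral equation until its constant term is nonzero;
  moving that term to the other side exhibits x as a divisor of it.\<close>

lemma algebraic_int_dvd_int:
  assumes "algebraic_int x" "x \<noteq> (0::complex)"
  obtains c :: int and B where "c \<noteq> 0" "x * poly (of_int_poly B) x = of_int c"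
proof -
  obtain p :: "int poly" where p: "poly (of_int_poly p) x = 0" "lead_coeff p = 1"
    using assms(1) by (auto simp: algebraic_int_altdef_ipoly)
  have "\<exists>c B. c \<noteq> 0 \<and> x * poly (of_int_poly B) x = of_int c"
    if "poly (of_int_poly p) x = 0" "p \<noteq> 0" for p :: "int poly"
    using that
  proof (induction p)
    case (pCons a p)
    show ?case
    proof (cases "a = 0")
      case True
      thus ?thesis using pCons assms(2) by auto
    next
      case False
      have "of_int a + x * poly (of_int_poly p) x = 0"
        using pCons.prems by simp
      hence "x * poly (of_int_poly p) x = of_int (- a)"
        by (simp add: add_eq_0_iff)
      thus ?thesis using False by (metis neg_equal_0_iff_equal)
    qed
  qed simp
  from this[OF p(1)] p(2) that show ?thesis by force
qed

text \<open>From x = p y the cofactor of \<open>algebraic_int_dvd_int\<close> produces p u = c with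
  a fixed nonzero integer c. Here u is rational and integral, hence an integer, so p \<le>
  |c|.\<close>

lemma Z_adjoin_dvd_finite_primes:
  assumes z: "z ^ n = 1" "n > 0" and x: "x \<in> Z_adjoin z" "x \<noteq> 0"
  obtains b :: nat where "\<And>p. p > b \<Longrightarrow> x \<notin> (*) (of_nat p) ` Z_adjoin z"
proof -
  obtain c B where cB: "c \<noteq> 0" "x * poly (of_int_poly B) x = of_int c"
    using algebraic_int_dvd_int[OF algebraic_int_Z_adjoin[OF z x(1)] x(2)] .
  have "x \<notin> (*) (of_nat p) ` Z_adjoin z" if p: "p > nat \<bar>c\<bar>" for p
  proof
    assume "x \<in> (*) (of_nat p) ` Z_adjoin z"
    then obtain y where y: "y \<in> Z_adjoin z" "x = of_nat p * y" by auto
    define u where "u = y * poly (of_int_poly B) x"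
    have u: "u \<in> Z_adjoin z" unfolding u_def using x y by auto
    have eq: "of_nat p * u = of_int c" using cB y by (simp add: u_def mult_ac)
    have "p > 0" using p by simp
    hence "u = of_int c / of_nat p" using eq by (simp add: field_simps)
    hence "u \<in> \<rat>" by simp
    hence "u \<in> \<int>" using Z_adjoin_Rats_imp_Ints[OF z u] by simp
    then obtain k where "u = of_int k" by (auto elim: Ints_cases)
    hence "of_int (int p * k) = (of_int c :: complex)" using eq by simp
    hence "int p * k = c" by (simp only: of_int_eq_iff)
    hence "int p dvd c" by auto
    hence "int p \<le> \<bar>c\<bar>" using cB(1) dvd_imp_le_int[of c "int p"] by simp
    thus False using p by linarith
  qed
  thus ?thesis using that by blast
qed

section \<open>The Frobenius congruence and the conjugates of a root of unity\<close>

lemma prime_power_binomial_cong: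
  assumes p: "prime p" and x: "x \<in> Z_adjoin z" and y: "y \<in> Z_adjoin z"
  shows "\<exists>c\<in>Z_adjoin z. (x + y) ^ p = x ^ p + y ^ p + of_nat p * c"
proof -
  have p0: "p > 0" using p prime_gt_0_nat by simp
  define c where "c = (\<Sum>k\<in>{0<..<p}. of_nat ((p choose k) div p) * x ^ k * y ^ (p - k))"
  have "(x + y) ^ p = (\<Sum>k\<le>p. of_nat (p choose k) * x ^ k * y ^ (p - k))"
    by (rule binomial_ring)
  also have "{..p} = insert 0 (insert p {0<..<p})" using p0 by auto
  also have "(\<Sum>k\<in>\<dots>. of_nat (p choose k) * x ^ k * y ^ (p - k)) =
    x ^ p + y ^ p + (\<Sum>k\<in>{0<..<p}. of_nat (p choose k) * x ^ k * y ^ (p - k))"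
    using p0 by (simp add: add_ac)
  also have "(\<Sum>k\<in>{0<..<p}. of_nat (p choose k) * x ^ k * y ^ (p - k)) = of_nat p * c"
    unfolding c_def sum_distrib_left
  proof (intro sum.cong refl)
    fix k assume k: "k \<in> {0<..<p}"
    have "p dvd (p choose k)" using k p by (intro dvd_choose_prime) auto
    hence "p choose k = p * ((p choose k) div p)" by simp
    thus "of_nat (p choose k) * x ^ k * y ^ (p - k) =
      of_nat p * (of_nat ((p choose k) div p) * x ^ k * y ^ (p - k))"
      by (metis mult.assoc of_nat_mult)
  qed
  finally show ?thesis using x y unfolding c_def by blast
qed

lemma Fermat_int:
  assumes "prime p"
  shows "\<exists>k::int. a ^ p = a + int p * k"
proof -
  have pos: "int p dvd int n ^ p - int n" for n :: nat
  proof (cases "p dvd n")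
    case True
    thus ?thesis using assms
      by (metis dvd_diff dvd_power dvd_trans int_dvd_int_iff prime_gt_0_nat)
  next
    case False
    with assms have "[n ^ (p - 1) = 1] (mod p)" by (rule fermat_theorem)
    hence "[n * n ^ (p - 1) = n * 1] (mod p)" by (rule cong_scalar_left)
    hence "[n ^ p = n] (mod p)"
      using assms by (metis mult.right_neutral power_minus_mult prime_gt_0_nat mult.commute)
    hence "[int n ^ p = int n] (mod int p)" by (metis cong_int_iff of_nat_power)
    thus ?thesis by (simp add: cong_iff_dvd_diff)
  qed
  have "int p dvd a ^ p - a"
  proof -
    have "[a ^ p = (a mod int p) ^ p] (mod int p)"
      by (intro cong_pow) (simp add: cong_def)
    also have "[(a mod int p) ^ p = a mod int p] (mod int p)"
      using pos[of "nat (a mod int p)"] assms prime_gt_0_nat[OF assms]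
      by (simp add: cong_iff_dvd_diff)
    also have "[a mod int p = a] (mod int p)" by (simp add: cong_def)
    finally show ?thesis by (simp add: cong_iff_dvd_diff)
  qed
  then obtain k where "a ^ p - a = int p * k" by (rule dvdE)
  thus ?thesis by (intro exI[of _ k]) simp
qed

text \<open>Coefficient by coefficient, additivity of the p-th power modulo p splits off the
  constant term a, and Fermat's little theorem turns a^p back into a.\<close>

lemma Frobenius_Z_adjoin:
  assumes p: "prime p"
  shows "\<exists>c\<in>Z_adjoin z. poly (of_int_poly A) (z ^ p) = poly (of_int_poly A) z ^ p + of_nat p * c"
proof (induction A)
  case 0
  show ?case using prime_gt_0_nat[OF p] by (intro bexI[of _ 0]) auto
next
  case (pCons a A)
  define V where "V = poly (of_int_poly A) z"
  have V: "V \<in> Z_adjoin z" by (auto simp: V_def)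
  obtain c where c: "c \<in> Z_adjoin z" "poly (of_int_poly A) (z ^ p) = V ^ p + of_nat p * c"
    using pCons.IH by (auto simp: V_def)
  obtain e where e: "e \<in> Z_adjoin z" "(of_int a + z * V) ^ p = of_int a ^ p + (z * V) ^ p + of_nat p * e"
    using prime_power_binomial_cong[OF p, of "of_int a" z "z * V"] V by auto
  obtain k where k: "a ^ p = a + int p * k" using Fermat_int[OF p] by blast
  have "of_int a ^ p = of_int a + of_nat p * (of_int k :: complex)"
    by (metis k of_int_add of_int_mult of_int_of_nat_eq of_int_power)
  hence "poly (of_int_poly (pCons a A)) (z ^ p) =
    poly (of_int_poly (pCons a A)) z ^ p + of_nat p * (z ^ p * c - e - of_int k)"
    using c e by (simp add: V_def algebra_simps power_mult_distrib)
  thus ?case using c(1) e(1) by blast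
qed

text \<open>If h(z^j) = 0, the Frobenius congruence makes h(z^(jp)) a multiple of p, which for a
  nonzero value only finitely many p allow. Powers of z take at most n values, so a single bound
  serves all j.\<close>

lemma root_of_unity_prime_conjugate:
  assumes z: "z ^ n = (1::complex)" "n > 0"
  obtains b :: nat where
    "\<And>p j. prime p \<Longrightarrow> p > b \<Longrightarrow> poly (of_int_poly h) (z ^ j) = 0 \<Longrightarrow> poly (of_int_poly h) (z ^ (j * p)) = 0"
proof -
  have "\<exists>b. \<forall>p>b. poly (of_int_poly h) (z ^ j) \<notin> (*) (of_nat p) ` Z_adjoin z"
    if "poly (of_int_poly h) (z ^ j) \<noteq> 0" for j
    using Z_adjoin_dvd_finite_primes[OF z, of "poly (of_int_poly h) (z ^ j)"] that by blast
  then obtain f where f: "\<And>j p. poly (of_int_poly h) (z ^ j) \<noteq> 0 \<Longrightarrow> p > f j \<Longrightarrow>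
      poly (of_int_poly h) (z ^ j) \<notin> (*) (of_nat p) ` Z_adjoin z"
    by metis
  have z_mod: "z ^ (k mod n) = z ^ k" for k
    by (rule power_cong_root_of_unity[OF z(1)]) simp
  have "poly (of_int_poly h) (z ^ (j * p)) = 0"
    if p: "prime p" "p > (\<Sum>j<n. f j)" and j: "poly (of_int_poly h) (z ^ j) = 0" for p j
  proof (rule ccontr)
    assume nz: "poly (of_int_poly h) (z ^ (j * p)) \<noteq> 0"
    have "f (j * p mod n) \<le> (\<Sum>j<n. f j)"
      using z by (intro member_le_sum) auto
    hence "poly (of_int_poly h) (z ^ (j * p)) \<notin> (*) (of_nat p) ` Z_adjoin z"
      using f[of "j * p mod n" p] nz p by (simp add: z_mod)
    moreover obtain c where c: "c \<in> Z_adjoin (z ^ j)"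
      "poly (of_int_poly h) ((z ^ j) ^ p) = poly (of_int_poly h) (z ^ j) ^ p + of_nat p * c"
      using Frobenius_Z_adjoin[OF p(1)] by blast
    have "c \<in> Z_adjoin z"
      using c(1) Z_adjoin_subset[of "z ^ j" z] by auto
    moreover have "poly (of_int_poly h) (z ^ (j * p)) = of_nat p * c"
      using c(2) j prime_gt_0_nat[OF p(1)] by (simp add: power_mult)
    ultimately show False by blast
  qed
  thus ?thesis using that by blast
qed

text \<open>An elementary substitute for Dirichlet's theorem on primes in progressions. In k + n
  \<Prod>P a small prime divides exactly one of the two summands: the first if it divides k, as it
  then divides neither n nor \<Prod>P, and the second otherwise.\<close>

lemma cong_large_prime_factors:
  fixes k n b :: nat
  assumes "coprime k n" "n > 0"
  obtains k' where "k' > 0" "[k' = k] (mod n)" "\<And>p. prime p \<Longrightarrow> p dvd k' \<Longrightarrow> p > b"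
proof -
  define P where "P = {p. prime p \<and> p \<le> b \<and> \<not> p dvd k}"
  have fin: "finite P" by (rule finite_subset[of _ "{..b}"]) (auto simp: P_def)
  define k' where "k' = k + n * \<Prod>P"
  have "\<Prod>P > 0" using fin by (intro prod_pos) (auto simp: P_def prime_gt_0_nat)
  hence "k' > 0" using assms by (simp add: k'_def)
  moreover have "[k' = k] (mod n)" by (simp add: k'_def cong_def)
  moreover have "p > b" if p: "prime p" "p dvd k'" for p
  proof (rule ccontr)
    assume "\<not> p > b"
    show False
    proof (cases "p dvd k")
      case True
      hence "p dvd n * \<Prod>P" using p(2) by (simp add: k'_def dvd_add_right_iff)
      moreover have "\<not> p dvd n"
        using True p(1) assms(1) by (metis coprime_common_divisor_nat not_prime_1)
      ultimately have "p dvd \<Prod>P" using p(1) by (simp add: prime_dvd_mult_iff)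
      then obtain q where "q \<in> P" "p dvd q" using p(1) fin by (auto simp: prime_dvd_prod_iff)
      hence "p = q" using p(1) by (simp add: P_def primes_dvd_imp_eq)
      thus False using True \<open>q \<in> P\<close> by (simp add: P_def)
    next
      case False
      hence "p \<in> P" using p \<open>\<not> p > b\<close> by (simp add: P_def)
      hence "p dvd \<Prod>P" using dvd_prodI[OF fin, of p "\<lambda>x. x"] by simp
      hence "p dvd k" using p(2) by (simp add: k'_def dvd_add_left_iff)
      thus False using False by simp
    qed
  qed
  ultimately show ?thesis using that by blast
qed

text \<open>The irreducibility of the cyclotomic polynomials in disguise: only for large primes is
  the Frobenius congruence needed, since every unit modulo \<open>n\<close> is a product of large primes.\<close>

lemma root_of_unity_conjugate_int:
  assumes z: "z ^ n = (1::complex)" "n > 0" and k: "coprime k n"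
    and h: "poly (of_int_poly h) z = 0"
  shows "poly (of_int_poly h) (z ^ k) = 0"
proof -
  obtain b where b: "\<And>p j. prime p \<Longrightarrow> p > b \<Longrightarrow> poly (of_int_poly h) (z ^ j) = 0 \<Longrightarrow>
      poly (of_int_poly h) (z ^ (j * p)) = 0"
    using root_of_unity_prime_conjugate[OF z] by metis
  obtain k' where k': "k' > 0" "[k' = k] (mod n)" "\<And>p. prime p \<Longrightarrow> p dvd k' \<Longrightarrow> p > b"
    using cong_large_prime_factors[OF k z(2)] by metis
  \<comment> \<open>The free starting exponent j absorbs one prime factor of m at a time.\<close>
  have "poly (of_int_poly h) (z ^ (j * m)) = 0"
    if "m > 0" "\<And>p. prime p \<Longrightarrow> p dvd m \<Longrightarrow> p > b" "poly (of_int_poly h) (z ^ j) = 0" for m j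
    using that
  proof (induction m arbitrary: j rule: less_induct)
    case (less m)
    show ?case
    proof (cases "m = 1")
      case False
      then obtain p where p: "prime p" "p dvd m" using prime_factor_nat by blast
      then obtain l where l: "m = p * l" by (elim dvdE)
      have "l < m" "l > 0" using less.prems(1) p(1) prime_gt_1_nat[of p] by (auto simp: l)
      moreover have "poly (of_int_poly h) (z ^ (j * p)) = 0" using less.prems p b by blast
      ultimately have "poly (of_int_poly h) (z ^ (j * p * l)) = 0"
        using less.prems(2) l by (intro less.IH[of l "j * p"]) auto
      thus ?thesis by (simp add: l mult_ac)
    qed (use less.prems in simp)
  qed
  from this[of k' 1] k' h have "poly (of_int_poly h) (z ^ k') = 0" by simp
  thus ?thesis using power_cong_root_of_unity[OF z(1) k'(2)] by simp
qed

text \<open>D and B do not depend on x, so one identity serves at a number and at its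
  conjugates.\<close>

lemma clear_denominators:
  fixes A :: "rat poly"
  obtains D :: int and B where "D > 0"
    "\<And>x::complex. of_int D * poly (map_poly of_rat A) x = poly (of_int_poly B) x"
proof -
  have "\<exists>D>0. \<exists>B. \<forall>x::complex. of_int D * poly (map_poly of_rat A) x = poly (of_int_poly B) x"
  proof (induction A)
    case 0
    show ?case by (intro exI[of _ 1] conjI exI[of _ 0]) auto
  next
    case (pCons a A)
    then obtain D B where DB: "D > 0"
      "\<And>x::complex. of_int D * poly (map_poly of_rat A) x = poly (of_int_poly B) x" by blast
    obtain r s where rs: "s > 0" "a = of_int r / of_int s"
      by (metis quotient_of_denom_pos quotient_of_div surj_pair)
    have "of_int (s * D) * poly (map_poly of_rat (pCons a A)) x = poly (of_int_poly (pCons (D * r) (smult s B))) x"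
      for x :: complex
    proof -
      have "of_int (s * D) * poly (map_poly of_rat (pCons a A)) x =
        of_int (s * D) * (of_rat a + x * poly (map_poly of_rat A) x)"
        by (simp add: of_rat_hom.map_poly_pCons_hom)
      also have "\<dots> = of_int D * (of_int s * of_rat a) + of_int s * x * (of_int D * poly (map_poly of_rat A) x)"
        by (simp add: algebra_simps)
      also have "of_int s * of_rat a = (of_int r :: complex)"
        using rs by (simp add: of_rat_divide)
      finally show ?thesis using DB(2) by (simp add: of_int_hom.map_poly_hom_smult)
    qed
    thus ?case using DB(1) rs(1) by (intro exI[of _ "s * D"] conjI exI[of _ "pCons (D * r) (smult s B)"]) auto
  qed
  thus ?thesis using that by blast
qed

lemma root_of_unity_conjugate:
  assumes z: "z ^ n = (1::complex)" "n > 0" and k: "coprime k n"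
    and h: "poly (map_poly of_rat h) z = 0"
  shows "poly (map_poly of_rat h) (z ^ k) = 0"
proof -
  obtain D B where DB: "D > 0"
    "\<And>x::complex. of_int D * poly (map_poly of_rat h) x = poly (of_int_poly B) x"
    using clear_denominators by blast
  have "poly (of_int_poly B) z = 0" using DB(2)[of z] h by simp
  hence "poly (of_int_poly B) (z ^ k) = 0" by (rule root_of_unity_conjugate_int[OF z k])
  thus ?thesis using DB(2)[of "z ^ k"] DB(1) by simp
qed

section \<open>Integral closedness\<close>

text \<open>Iterating the congruence keeps the modulus p: the p-th power of an error term p c is
  again a multiple of p.\<close>

lemma Frobenius_power_Z_adjoin:
  assumes p: "prime p"
  shows "\<exists>c\<in>Z_adjoin z. poly (of_int_poly A) (z ^ p ^ s) = poly (of_int_poly A) z ^ p ^ s + of_nat p * c"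
proof (induction s)
  case (Suc s)
  define u where "u = poly (of_int_poly A) z ^ p ^ s"
  have u: "u \<in> Z_adjoin z" unfolding u_def by auto
  obtain c where c: "c \<in> Z_adjoin z" "poly (of_int_poly A) (z ^ p ^ s) = u + of_nat p * c"
    using Suc.IH unfolding u_def by blast
  obtain e where e: "e \<in> Z_adjoin (z ^ p ^ s)" "poly (of_int_poly A) ((z ^ p ^ s) ^ p) =
      poly (of_int_poly A) (z ^ p ^ s) ^ p + of_nat p * e"
    using Frobenius_Z_adjoin[OF p] by blast
  have e': "e \<in> Z_adjoin z" using e(1) Z_adjoin_subset[of "z ^ p ^ s" z] by auto
  have pc: "of_nat p * c \<in> Z_adjoin z" using c(1) by auto
  obtain g where g: "g \<in> Z_adjoin z" "(u + of_nat p * c) ^ p = u ^ p + (of_nat p * c) ^ p + of_nat p * g"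
    using prime_power_binomial_cong[OF p u pc] by blast
  have "(of_nat p * c) ^ p = of_nat p * (c * (of_nat p * c) ^ (p - 1))"
    using prime_gt_0_nat[OF p] by (metis mult.assoc power_eq_if not_gr_zero)
  hence "poly (of_int_poly A) (z ^ p ^ Suc s) =
    poly (of_int_poly A) z ^ p ^ Suc s + of_nat p * (c * (of_nat p * c) ^ (p - 1) + g + e)"
    using c(2) e(2) g(2) by (simp add: u_def algebra_simps flip: power_mult)
  thus ?case using c(1) g(1) e' pc by blast
qed (auto intro!: bexI[of _ 0])

section \<open>Principal ideals of \<int>[z] and reduced quotients\<close>

lemma ideal_add: "x \<in> (*) a ` Z_adjoin z \<Longrightarrow> y \<in> (*) a ` Z_adjoin z \<Longrightarrow> x + y \<in> (*) a ` Z_adjoin z"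
  by (auto simp flip: distrib_left)

lemma ideal_mult: "x \<in> (*) a ` Z_adjoin z \<Longrightarrow> y \<in> Z_adjoin z \<Longrightarrow> x * y \<in> (*) a ` Z_adjoin z"
  by (auto simp: mult.assoc)

lemma ideal_diff: "x \<in> (*) a ` Z_adjoin z \<Longrightarrow> y \<in> (*) a ` Z_adjoin z \<Longrightarrow> x - y \<in> (*) a ` Z_adjoin z"
  by (auto simp flip: right_diff_distrib)

lemma ideal_sum: "(\<And>i. i \<in> I \<Longrightarrow> f i \<in> (*) a ` Z_adjoin z) \<Longrightarrow> sum f I \<in> (*) a ` Z_adjoin z"
  by (induction I rule: infinite_finite_induct) (auto intro: ideal_add)

lemma poly_ideal_cong:
  assumes "x \<in> Z_adjoin z" "y \<in> Z_adjoin z" "x - y \<in> (*) a ` Z_adjoin z"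
  shows "poly (of_int_poly A) x - poly (of_int_poly A) y \<in> (*) a ` Z_adjoin z"
proof (induction A)
  case (pCons c A)
  have "(poly (of_int_poly A) x - poly (of_int_poly A) y) * x + (x - y) * poly (of_int_poly A) y
    \<in> (*) a ` Z_adjoin z"
    using assms pCons.IH by (intro ideal_add ideal_mult Z_adjoin_poly)
  thus ?case by (simp add: algebra_simps)
qed auto

text \<open>The quotient of \<open>\<int>[z]\<close> by \<open>a\<close> is reduced, because there \<open>x \<mapsto> x\<^sup>q\<close> is the identity.\<close>

lemma ideal_radical:
  assumes p: "prime p" and pa: "of_nat p \<in> (*) a ` Z_adjoin z"
    and zq: "z ^ p ^ s - z \<in> (*) a ` Z_adjoin z" and s: "s > 0"
    and x: "x \<in> Z_adjoin z" "x ^ k \<in> (*) a ` Z_adjoin z"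
  shows "x \<in> (*) a ` Z_adjoin z"
proof -
  \<comment> \<open>With q = p^s and y = A(z), the congruence gives y^q = A(z^q) modulo p, hence
    modulo a, and there z^q = z.\<close>
  have fixp: "y ^ p ^ s - y \<in> (*) a ` Z_adjoin z" if y: "y \<in> Z_adjoin z" for y
  proof -
    obtain A where A: "y = poly (of_int_poly A) z" using y by (rule Z_adjoinE)
    obtain c where c: "c \<in> Z_adjoin z" "poly (of_int_poly A) (z ^ p ^ s) = y ^ p ^ s + of_nat p * c"
      using Frobenius_power_Z_adjoin[OF p] unfolding A by blast
    have "poly (of_int_poly A) (z ^ p ^ s) - y \<in> (*) a ` Z_adjoin z"
      unfolding A using zq by (intro poly_ideal_cong) auto
    from ideal_diff[OF this ideal_mult[OF pa c(1)]] show ?thesis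
      by (simp add: c(2))
  qed
  have iter: "x ^ p ^ (s * j) - x \<in> (*) a ` Z_adjoin z" for j
  proof (induction j)
    case (Suc j)
    have "(x ^ p ^ (s * j)) ^ p ^ s - x ^ p ^ (s * j) \<in> (*) a ` Z_adjoin z"
      using x(1) by (intro fixp) auto
    from ideal_add[OF this Suc] show ?case
      by (simp add: power_add mult.commute flip: power_mult)
  qed auto
  \<comment> \<open>As k is below p^(sk), the factor x^k splits off from x^(p^(sk)), which is
    congruent to x modulo a.\<close>
  have "k < 2 ^ k" by simp
  also have "(2::nat) ^ k \<le> p ^ k" using prime_ge_2_nat[OF p] by (intro power_mono) auto
  also have "\<dots> \<le> p ^ (s * k)" using s prime_gt_0_nat[OF p] by (intro power_increasing) auto
  finally have "x ^ p ^ (s * k) = x ^ k * x ^ (p ^ (s * k) - k)"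
    by (simp flip: power_add)
  also have "\<dots> \<in> (*) a ` Z_adjoin z" using x by (intro ideal_mult) auto
  finally show ?thesis using ideal_diff[OF _ iter[of k]] by fastforce
qed

text \<open>Multiply the monic equation of \<alpha> by s^k with s = a r. Every term except the
  leading one keeps a factor a, so (s \<alpha>)^k lies in the ideal of a. Radicality puts s \<alpha>
  there too, and a cancels.\<close>

lemma integral_descent:
  assumes \<alpha>: "algebraic_int \<alpha>" and a: "a \<in> Z_adjoin z" "a \<noteq> 0" and r: "r \<in> Z_adjoin z"
    and arx: "a * r * \<alpha> \<in> Z_adjoin z"
    and rad: "\<And>x k. x \<in> Z_adjoin z \<Longrightarrow> x ^ k \<in> (*) a ` Z_adjoin z \<Longrightarrow> x \<in> (*) a ` Z_adjoin z"
  shows "r * \<alpha> \<in> Z_adjoin z"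
proof -
  obtain f :: "int poly" where f: "poly (of_int_poly f) \<alpha> = 0" "lead_coeff f = 1"
    using \<alpha> by (auto simp: algebraic_int_altdef_ipoly)
  define k where "k = degree f"
  define s where "s = a * r"
  have "0 = (\<Sum>i\<le>k. of_int (coeff f i) * \<alpha> ^ i)"
    using f(1) by (simp add: poly_altdef k_def)
  also have "\<dots> = (\<Sum>i<k. of_int (coeff f i) * \<alpha> ^ i) + \<alpha> ^ k"
    using f(2) by (simp add: k_def flip: lessThan_Suc_atMost)
  finally have "\<alpha> ^ k = - (\<Sum>i<k. of_int (coeff f i) * \<alpha> ^ i)"
    by (simp add: eq_neg_iff_add_eq_0 add.commute)
  hence "(s * \<alpha>) ^ k = - (\<Sum>i<k. s ^ k * (of_int (coeff f i) * \<alpha> ^ i))"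
    by (simp add: power_mult_distrib sum_distrib_left)
  also have "\<dots> = (\<Sum>i<k. a * (- of_int (coeff f i) * r * s ^ (k - i - 1) * (s * \<alpha>) ^ i))"
    unfolding sum_negf[symmetric]
  proof (intro sum.cong refl)
    fix i assume i: "i \<in> {..<k}"
    \<comment> \<open>Of the k factors s, i accompany \<alpha>^i and one supplies the factor
      a.\<close>
    have "k = i + Suc (k - i - 1)" using i by auto
    hence "s ^ k = s ^ i * (s * s ^ (k - i - 1))" by (metis power_Suc power_add)
    thus "- (s ^ k * (of_int (coeff f i) * \<alpha> ^ i)) =
      a * (- of_int (coeff f i) * r * s ^ (k - i - 1) * (s * \<alpha>) ^ i)"
      by (simp add: s_def power_mult_distrib mult_ac)
  qed
  also have "\<dots> \<in> (*) a ` Z_adjoin z"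
  proof (intro ideal_sum imageI)
    fix i
    have "s \<in> Z_adjoin z" unfolding s_def by (rule Z_adjoin_mult[OF a(1) r])
    moreover have "(s * \<alpha>) ^ i \<in> Z_adjoin z" using arx unfolding s_def by (rule Z_adjoin_power)
    ultimately show "- of_int (coeff f i) * r * s ^ (k - i - 1) * (s * \<alpha>) ^ i \<in> Z_adjoin z"
      by (metis Z_adjoin_mult Z_adjoin_power Z_adjoin_uminus Z_adjoin_of_int r)
  qed
  finally have "s * \<alpha> \<in> (*) a ` Z_adjoin z"
    by (rule rad[rotated]) (use arx in \<open>simp add: s_def\<close>)
  then obtain y where y: "y \<in> Z_adjoin z" "s * \<alpha> = a * y" by blast
  hence "r * \<alpha> = y" using a(2) by (simp add: s_def mult.assoc)
  thus ?thesis using y(1) by simp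
qed

lemma Z_adjoin_1_minus_power: "x \<in> Z_adjoin z \<Longrightarrow> 1 - x ^ j \<in> (*) (1 - x) ` Z_adjoin z"
proof (induction j)
  case (Suc j)
  have "1 - x ^ Suc j = (1 - x ^ j) * x + (1 - x) * 1" by (simp add: algebra_simps)
  also have "\<dots> \<in> (*) (1 - x) ` Z_adjoin z"
    using Suc by (intro ideal_add ideal_mult imageI) auto
  finally show ?case .
qed auto

text \<open>At a prime \<open>p\<close> dividing the order \<open>n = p\<^sup>am\<close> of \<open>z\<close>, the element \<open>1 - z\<^sup>m\<close> generates the
  radical of \<open>p\<int>[z]\<close>; at the other primes \<open>p\<int>[z]\<close> is already radical.\<close>

lemma radical_generator:
  assumes z: "z ^ n = (1::complex)" "n > 0" and p: "prime p"
  obtains a k where "a \<in> Z_adjoin z" "a \<noteq> 0" "a ^ k \<in> (*) (of_nat p) ` Z_adjoin z"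
    "\<And>x j. x \<in> Z_adjoin z \<Longrightarrow> x ^ j \<in> (*) a ` Z_adjoin z \<Longrightarrow> x \<in> (*) a ` Z_adjoin z"
proof -
  \<comment> \<open>N is the exact order of z, of which \<open>n\<close> is a multiple; its
    minimality makes \<open>x\<close> below differ from 1.\<close>
  define N where "N = (LEAST n. n > 0 \<and> z ^ n = 1)"
  have N: "N > 0" "z ^ N = 1"
    using LeastI[of "\<lambda>n. n > 0 \<and> z ^ n = 1" n] z by (auto simp: N_def)
  have N_min: "z ^ i \<noteq> 1" if "i > 0" "i < N" for i
    using not_less_Least[of i "\<lambda>n. n > 0 \<and> z ^ n = 1"] that by (auto simp: N_def)
  define e where "e = multiplicity p N"
  obtain m where m: "N = p ^ e * m" "\<not> p dvd m"
    using multiplicity_decompose'[of N p] N(1) p not_prime_unit unfolding e_def by blast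
  have "m > 0" using N(1) m by (cases "m = 0") auto
  \<comment> \<open>By Euler's theorem p^s = 1 modulo m, so z^(p^s - 1) is a power of y = z^m and
    z^(p^s) - z is a multiple of 1 - y.\<close>
  define s where "s = totient m"
  have s: "s > 0" using \<open>m > 0\<close> by (simp add: s_def)
  have "coprime p m" using p m(2) by (simp add: prime_imp_coprime)
  hence ps: "[p ^ s = 1] (mod m)" unfolding s_def by (rule euler_theorem)
  have p0: "p > 0" using p prime_gt_0_nat by blast
  have "m dvd p ^ s - 1" using ps p0 cong_altdef_nat[of 1 "p ^ s" m] by simp
  then obtain t where t: "p ^ s - 1 = m * t" by (elim dvdE)
  define y where "y = z ^ m"
  have y: "y \<in> Z_adjoin z" by (auto simp: y_def)
  have "z ^ p ^ s = z * z ^ (p ^ s - 1)" using p0 by (simp flip: power_Suc)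
  also have "z ^ (p ^ s - 1) = y ^ t" unfolding t y_def power_mult ..
  finally have zps: "z ^ p ^ s - z = (1 - y ^ t) * - z" by (simp add: algebra_simps)
  show ?thesis
  proof (cases "e = 0")
    \<comment> \<open>The unramified case: y = 1, hence z^(p^s) = z, and a = p serves.\<close>
    case True
    hence "y = 1" using N m by (simp add: y_def)
    hence "z ^ p ^ s - z \<in> (*) (of_nat p) ` Z_adjoin z" using zps by (auto intro: image_eqI[of _ _ 0])
    moreover have "of_nat p \<in> (*) (of_nat p) ` Z_adjoin z" by (rule image_eqI[of _ _ 1]) auto
    ultimately have "x \<in> (*) (of_nat p) ` Z_adjoin z"
      if "x \<in> Z_adjoin z" "x ^ j \<in> (*) (of_nat p) ` Z_adjoin z" for x j
      using ideal_radical[OF p _ _ s that] by blast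
    moreover have "of_nat p ^ 1 \<in> (*) (of_nat p) ` Z_adjoin z" by (rule image_eqI[of _ _ 1]) auto
    ultimately show ?thesis
      using p0 that[of "of_nat p" 1] by (metis Z_adjoin_of_nat of_nat_0_eq_iff not_gr_zero)
  next
    case False
    define a where "a = 1 - y"
    \<comment> \<open>x has order exactly p, so 1 + x + ... + x^(p-1) = 0. Therefore p is the sum of
      the 1 - x^i, all multiples of a = 1 - y.\<close>
    define x where "x = y ^ p ^ (e - 1)"
    have "p ^ (e - 1) < p ^ e" using False prime_gt_1_nat[OF p] by (intro power_strict_increasing) auto
    hence "p ^ (e - 1) * m < N" using \<open>m > 0\<close> by (simp add: m(1))
    hence "x \<noteq> 1" using N_min[of "p ^ (e - 1) * m"] p0 \<open>m > 0\<close>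
      by (simp add: x_def y_def mult.commute flip: power_mult)
    have "x ^ p = y ^ p ^ e"
      using False by (simp add: x_def mult.commute flip: power_mult power_Suc)
    also have y_pow: "y ^ p ^ e = 1" using N by (simp add: y_def m(1) mult.commute flip: power_mult)
    finally have "(\<Sum>i<p. x ^ i) = 0" using \<open>x \<noteq> 1\<close> by (simp add: sum_gp_strict)
    hence "of_nat p = (\<Sum>i<p. 1 - x ^ i)" by (simp add: sum_subtractf)
    also have "\<dots> \<in> (*) a ` Z_adjoin z"
      unfolding a_def x_def power_mult[symmetric] by (intro ideal_sum Z_adjoin_1_minus_power y)
    finally have pa: "of_nat p \<in> (*) a ` Z_adjoin z" .
    have "a \<noteq> 0" using \<open>x \<noteq> 1\<close> by (auto simp: a_def x_def)
    moreover have "a \<in> Z_adjoin z" using y by (auto simp: a_def)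
    moreover have "a ^ p ^ e \<in> (*) (of_nat p) ` Z_adjoin z"
    proof -
      \<comment> \<open>The Frobenius congruence for the polynomial 1 - X at y, whose p^e-th power
        is 1.\<close>
      obtain c where c: "c \<in> Z_adjoin y"
        "poly (of_int_poly [:1, -1:]) (y ^ p ^ e) = poly (of_int_poly [:1, -1:]) y ^ p ^ e + of_nat p * c"
        using Frobenius_power_Z_adjoin[OF p] by blast
      have "a ^ p ^ e = of_nat p * - c"
        using c(2) y_pow by (simp add: a_def eq_neg_iff_add_eq_0)
      moreover have "- c \<in> Z_adjoin z" using c(1) Z_adjoin_subset[OF y] by auto
      ultimately show ?thesis by blast
    qed
    moreover have zps': "z ^ p ^ s - z \<in> (*) a ` Z_adjoin z"
      unfolding zps a_def by (intro ideal_mult Z_adjoin_1_minus_power y) auto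
    ultimately show ?thesis
      using that[of a "p ^ e"] ideal_radical[OF p pa zps' s] by blast
  qed
qed

text \<open>One prime p of the denominator D = p d is removed at a time: some a^k is a multiple of
  p, so a^k d \<alpha> lies in \<int>[z], and \<open>integral_descent\<close> cancels the k factors
  a one by one.\<close>

theorem Z_adjoin_integrally_closed:
  assumes z: "z ^ n = (1::complex)" "n > 0" and \<alpha>: "algebraic_int \<alpha>"
    and D: "D > 0" "of_nat D * \<alpha> \<in> Z_adjoin z"
  shows "\<alpha> \<in> Z_adjoin z"
  using D
proof (induction D rule: less_induct)
  case (less D)
  show ?case
  proof (cases "D = 1")
    case False
    then obtain p where p: "prime p" "p dvd D" using prime_factor_nat by blast
    then obtain d where d: "D = p * d" by (elim dvdE)
    obtain a k where a: "a \<in> Z_adjoin z" "a \<noteq> 0" "a ^ k \<in> (*) (of_nat p) ` Z_adjoin z"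
      "\<And>x j. x \<in> Z_adjoin z \<Longrightarrow> x ^ j \<in> (*) a ` Z_adjoin z \<Longrightarrow> x \<in> (*) a ` Z_adjoin z"
      using radical_generator[OF z p(1)] by metis
    obtain c where c: "c \<in> Z_adjoin z" "a ^ k = of_nat p * c" using a(3) by blast
    have "a ^ k * of_nat d * \<alpha> = c * (of_nat D * \<alpha>)" by (simp add: c(2) d)
    hence start: "a ^ k * of_nat d * \<alpha> \<in> Z_adjoin z" using c(1) less.prems(2) by (metis Z_adjoin_mult)
    have "of_nat d * \<alpha> \<in> Z_adjoin z" if "a ^ i * of_nat d * \<alpha> \<in> Z_adjoin z" for i
      using that
    proof (induction i)
      case (Suc i)
      have h: "a * (a ^ i * of_nat d) * \<alpha> \<in> Z_adjoin z" using Suc.prems by (simp add: mult_ac)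
      have "a ^ i * of_nat d * \<alpha> \<in> Z_adjoin z"
        by (rule integral_descent[OF \<alpha> a(1,2) _ h a(4)]) (use a(1) in auto)
      thus ?case by (rule Suc.IH)
    qed simp
    from this[OF start] have "of_nat d * \<alpha> \<in> Z_adjoin z" .
    moreover have "d < D" "d > 0" using less.prems(1) prime_gt_1_nat[OF p(1)] by (auto simp: d)
    ultimately show ?thesis using less.IH by blast
  qed (use less.prems in simp)
qed

section \<open>Units modulo sign\<close>

text \<open>For d > 2 there are \<phi>(d)/2 units modulo d up to sign, so the divisibility forces
  the class of g to have full order, that is, to generate that group.\<close>

definition generates_mod_sign :: "nat \<Rightarrow> nat \<Rightarrow> bool" where
  "generates_mod_sign d g \<longleftrightarrow> coprime g d \<and>
     (\<forall>j. \<forall>\<epsilon>\<in>{1, -1 :: int}. [int g ^ j = \<epsilon>] (mod int d) \<longrightarrow> totient d div 2 dvd j)"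

lemma cong_sign_square:
  assumes "[int g ^ j = \<epsilon>] (mod int d)" "\<epsilon> \<in> {1, -1 :: int}"
  shows "[g ^ (2 * j) = 1] (mod d)"
proof -
  have "[(int g ^ j)\<^sup>2 = \<epsilon>\<^sup>2] (mod int d)" using assms(1) by (rule cong_pow)
  moreover have "\<epsilon>\<^sup>2 = 1" using assms(2) by auto
  ultimately have "[int (g ^ (2 * j)) = int 1] (mod int d)"
    by (simp add: mult.commute flip: power_mult)
  thus ?thesis unfolding cong_int_iff .
qed

text \<open>A primitive root g works: squaring removes the sign, so \<phi>(p^i) divides 2j.\<close>

lemma prime_power_generates_mod_sign:
  assumes p: "prime p" "odd p" and i: "i > 0"
  shows "\<exists>g. generates_mod_sign (p ^ i) g"
proof -
  obtain g where g: "residue_primroot (p ^ i) g"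
    using residue_primroot_odd_prime_power_exists[OF p] i by metis
  hence co: "coprime g (p ^ i)" and ord: "ord (p ^ i) g = totient (p ^ i)"
    by (auto simp: residue_primroot_def coprime_commute)
  have "p > 2" using p prime_ge_2_nat[of p] by (cases "p = 2") auto
  hence "p ^ i > 2" using i by (metis less_le_trans self_le_power prime_ge_1_nat p(1))
  hence ev: "even (totient (p ^ i))" by (rule totient_even)
  have "totient (p ^ i) div 2 dvd j" if "[int g ^ j = \<epsilon>] (mod int (p ^ i))" "\<epsilon> \<in> {1, -1}" for j and \<epsilon> :: int
  proof -
    have "totient (p ^ i) dvd 2 * j"
      using cong_sign_square[OF that] ord by (simp only: ord_divides)
    thus ?thesis using ev by (auto elim!: evenE)
  qed
  thus ?thesis unfolding generates_mod_sign_def using co by blast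
qed

text \<open>The square \<open>h\<^sup>2\<close> has odd order modulo \<open>Q\<close>, so no power of \<open>x\<close> is \<open>-1\<close> modulo \<open>Q\<close>.\<close>

lemma product_generates_mod_sign:
  fixes P Q :: nat
  assumes PQ: "coprime P Q" and P: "residue_primroot P g" "P > 2"
    and Q: "residue_primroot Q h" "Q > 2"
    and gcd: "gcd (totient P) (totient Q) dvd 2" and odd: "odd (totient Q div 2)"
  shows "\<exists>x. generates_mod_sign (P * Q) x"
proof -
  obtain x where x: "[x = g] (mod P)" "[x = h\<^sup>2] (mod Q)"
    using binary_chinese_remainder_nat[OF PQ] by blast
  define B where "B = totient Q div 2"
  have B: "totient Q = 2 * B" using totient_even[OF Q(2)] by (simp add: B_def)
  have "coprime x P" using P(1) cong_sym[OF x(1)]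
    by (metis cong_imp_coprime coprime_commute residue_primroot_def)
  moreover have "coprime x Q"
    using Q(1) cong_sym[OF x(2)]
    by (metis cong_imp_coprime coprime_commute residue_primroot_def coprime_power_right_iff)
  ultimately have "coprime x (P * Q)" by simp
  moreover have "totient (P * Q) div 2 dvd j"
    if j: "[int x ^ j = \<epsilon>] (mod int (P * Q))" "\<epsilon> \<in> {1, -1}" for j and \<epsilon> :: int
  proof -
    have jP: "[int x ^ j = \<epsilon>] (mod int P)" and jQ: "[int x ^ j = \<epsilon>] (mod int Q)"
      using j(1) by (auto intro: cong_dvd_modulus)
    have "[(h\<^sup>2) ^ (2 * j) = x ^ (2 * j)] (mod Q)" using x(2) by (intro cong_pow) (rule cong_sym)
    also have "[x ^ (2 * j) = 1] (mod Q)" using cong_sign_square[OF jQ j(2)] .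
    finally have "[h ^ (4 * j) = 1] (mod Q)" by (simp flip: power_mult)
    hence "2 * B dvd 4 * j" using Q(1) B by (simp only: ord_divides residue_primroot_def)
    hence "B dvd 2 * j" by simp
    hence Bj: "B dvd j" using odd by (simp add: B_def coprime_dvd_mult_right_iff)
    hence "totient Q dvd 2 * j" using B by simp
    hence "[h ^ (2 * j) = 1] (mod Q)" using Q(1) by (simp only: ord_divides residue_primroot_def)
    hence "[(h\<^sup>2) ^ j = 1] (mod Q)" by (simp flip: power_mult)
    moreover have "[x ^ j = (h\<^sup>2) ^ j] (mod Q)" using x(2) by (rule cong_pow)
    ultimately have "[x ^ j = 1] (mod Q)" using cong_trans by blast
    hence "[int (x ^ j) = int 1] (mod int Q)" unfolding cong_int_iff .
    hence "[int x ^ j = 1] (mod int Q)" by simp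
    hence "[\<epsilon> = 1] (mod int Q)" using jQ cong_trans cong_sym by blast
    hence "int Q dvd \<epsilon> - 1" by (simp add: cong_iff_dvd_diff)
    \<comment> \<open>The sign -1 would make Q divide 2.\<close>
    hence "\<epsilon> = 1" using j(2) Q(2) zdvd_imp_le[of "int Q" 2] by auto
    hence "[int (x ^ j) = int 1] (mod int P)" using jP by simp
    hence "[x ^ j = 1] (mod P)" unfolding cong_int_iff .
    moreover have "[g ^ j = x ^ j] (mod P)" using x(1) by (intro cong_pow) (rule cong_sym)
    ultimately have "[g ^ j = 1] (mod P)" using cong_trans by blast
    hence Pj: "totient P dvd j" using P(1) by (simp only: ord_divides residue_primroot_def)
    \<comment> \<open>The orders \<phi>(P) of x modulo P and B of x modulo Q are coprime, so j is a
      multiple of their product, which is \<phi>(PQ)/2.\<close>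
    have "coprime (totient P) B"
    proof (rule coprimeI)
      fix c assume c: "c dvd totient P" "c dvd B"
      hence "c dvd gcd (totient P) (totient Q)" using B by simp
      hence "c dvd 2" using gcd by (rule dvd_trans)
      hence "c = 1 \<or> c = 2" by (metis prime_nat_iff two_is_prime_nat)
      thus "is_unit c" using odd c(2) by (auto simp: B_def)
    qed
    hence "totient P * B dvd j" using Pj Bj by (simp add: divides_mult)
    thus ?thesis using PQ B by (simp add: totient_mult_coprime)
  qed
  ultimately show ?thesis unfolding generates_mod_sign_def by blast
qed

text \<open>For odd N only the forms p^a and p^a q^b remain. If both primes divide d = u v, the gcd
  condition descends to u and v, so \<phi>(u) and \<phi>(v) are not both divisible by 4; the one
  with odd half takes the role of Q in \<open>product_generates_mod_sign\<close>.\<close>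

lemma condition_C_generates_mod_sign:
  assumes N: "condition_C N" "odd N" and d: "d dvd N" "d > 1"
  shows "\<exists>g. generates_mod_sign d g"
proof -
  obtain a b p q where pq: "a > 0" "b > 0" "prime p" "odd p" "prime q" "odd q" "p \<noteq> q"
    "N \<in> {2 ^ a, p ^ a, 2 * p ^ a, 4 * p ^ a} \<or>
         N \<in> {p ^ a * q ^ b, 2 * p ^ a * q ^ b} \<and>
           gcd (totient (p ^ a)) (totient (q ^ b)) = 2"
    using N(1) unfolding condition_C_def by blast
  have "N = p ^ a \<or> N = p ^ a * q ^ b \<and> gcd (totient (p ^ a)) (totient (q ^ b)) = 2"
    using pq(1,8) N(2) by auto
  \<comment> \<open>Both forms of N are treated as divisors of p^a q^b; \<open>gcd\<close> records
    when the gcd condition is available.\<close>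
  hence "d dvd p ^ a * q ^ b" and gcd: "d dvd p ^ a \<or> gcd (totient (p ^ a)) (totient (q ^ b)) = 2"
    using d(1) by (auto intro: dvd_mult2)
  then obtain u v where uv: "d = u * v" "u dvd p ^ a" "v dvd q ^ b"
    using division_decomp by blast
  obtain i j where ij: "u = p ^ i" "i \<le> a" "v = q ^ j" "j \<le> b"
    using uv pq divides_primepow_nat by metis
  consider "i = 0" | "j = 0" | "i > 0" "j > 0" by blast
  thus ?thesis
  proof cases
    case 1
    thus ?thesis using prime_power_generates_mod_sign[OF pq(5,6), of j] d(2) uv(1) ij
      by (cases "j = 0") auto
  next
    case 2
    thus ?thesis using prime_power_generates_mod_sign[OF pq(3,4), of i] d(2) uv(1) ij
      by (cases "i = 0") auto
  next
    case 3
    have co: "coprime u v" using pq by (simp add: ij primes_coprime)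
    have "p > 2" "q > 2" using pq(3-6) prime_ge_2_nat[of p] prime_ge_2_nat[of q]
      by (cases "p = 2"; cases "q = 2"; auto)+
    hence gt: "u > 2" "v > 2" using 3 unfolding ij
      by (metis less_le_trans self_le_power prime_ge_1_nat pq(3,5))+
    have "\<not> d dvd p ^ a"
    proof
      assume "d dvd p ^ a"
      hence "q dvd p ^ a" using uv(1) 3 by (metis ij(3) dvd_mult dvd_power dvd_trans)
      thus False using pq by (metis prime_dvd_power primes_dvd_imp_eq)
    qed
    hence "gcd (totient (p ^ a)) (totient (q ^ b)) = 2" using gcd by blast
    moreover have "totient u dvd totient (p ^ a)" "totient v dvd totient (q ^ b)"
      using uv by (auto intro: totient_dvd)
    ultimately have g: "gcd (totient u) (totient v) dvd 2" by (metis gcd_mono)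
    obtain x y where xy: "residue_primroot u x" "residue_primroot v y"
      using residue_primroot_odd_prime_power_exists pq(3-6) 3 unfolding ij by metis
    have ev: "even (totient u)" "even (totient v)" using gt by (auto intro: totient_even)
    have "odd (totient v div 2) \<or> odd (totient u div 2)"
    proof (rule ccontr)
      assume "\<not> ?thesis"
      hence "4 dvd totient u" "4 dvd totient v" using ev by (auto elim!: evenE)
      hence "4 dvd gcd (totient u) (totient v)" by simp
      hence "(4::nat) dvd 2" using g by (rule dvd_trans)
      thus False by simp
    qed
    thus ?thesis
    proof
      assume "odd (totient v div 2)"
      thus ?thesis using product_generates_mod_sign[OF co xy(1) gt(1) xy(2) gt(2) g] uv(1) by simp
    next
      assume "odd (totient u div 2)"
      thus ?thesis
        using product_generates_mod_sign[OF _ xy(2) gt(2) xy(1) gt(1)] co g uv(1)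
        by (simp add: coprime_commute gcd.commute mult.commute)
    qed
  qed
qed

section \<open>Factorization of the polynomials \<open>w\<^sub>n\<close>\<close>

lemma prod_linear_factors_dvd:
  fixes p :: "'a::idom poly"
  assumes "finite S" "\<And>x. x \<in> S \<Longrightarrow> poly p x = 0"
  shows "(\<Prod>x\<in>S. [:- x, 1:]) dvd p"
  using assms
proof (induction S arbitrary: p rule: finite_induct)
  case (insert x S)
  obtain q where q: "p = [:- x, 1:] * q"
    using insert.prems[of x] by (auto simp: poly_eq_0_iff_dvd elim: dvdE)
  have "poly q y = 0" if "y \<in> S" for y
  proof -
    have "(y - x) * poly q y = 0" using insert.prems[of y] that by (simp add: q algebra_simps)
    moreover have "y \<noteq> x" using that insert.hyps by auto
    ultimately show ?thesis by simp
  qed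
  from insert.IH[OF this] show ?case
    unfolding prod.insert[OF insert.hyps] q by (rule mult_dvd_mono[OF dvd_refl])
qed simp

lemma degree_prod_linear_factors:
  "finite S \<Longrightarrow> degree (\<Prod>x\<in>S. [:- f x, 1:] :: 'a::idom poly) = card S"
  by (subst degree_prod_eq_sum_degree) auto

lemma monic_dvd_imp_eq:
  fixes p q :: "'a::field poly"
  assumes "p dvd q" "lead_coeff p = 1" "lead_coeff q = 1" "degree p = degree q"
  shows "p = q"
proof -
  obtain h where h: "q = p * h" using assms(1) by (elim dvdE)
  have "p \<noteq> 0" "h \<noteq> 0" using assms(2,3) h by auto
  hence "degree h = 0" using assms(4) by (simp add: h degree_mult_eq)
  then obtain c where "h = [:c:]" by (elim degree_eq_zeroE)
  moreover have "lead_coeff h = 1" using assms(2,3) by (simp add: h lead_coeff_mult)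
  ultimately show ?thesis using h by simp
qed

text \<open>Pseudo-division scales the dividend by a power of the leading coefficient of g, here 1,
  so it is genuine division even over the integers.\<close>

lemma monic_division:
  fixes f g :: "'a::idom poly"
  assumes "lead_coeff g = 1"
  obtains q r where "f = g * q + r" "r = 0 \<or> degree r < degree g"
proof -
  obtain q r where qr: "pseudo_divmod f g = (q, r)" by (cases "pseudo_divmod f g")
  have "g \<noteq> 0" using assms by auto
  from pseudo_divmod[OF this qr] assms that show ?thesis by auto
qed

section \<open>The roots of \<open>w n\<close> and of \<open>Omega d\<close>\<close>

lemma monic_w: "degree (w (Suc n)) = n \<and> lead_coeff (w (Suc n)) = 1"
proof -
  \<comment> \<open>The recursion looks back two steps, so two consecutive indices are carried
    along.\<close>
  have "degree (w (Suc n)) = n \<and> lead_coeff (w (Suc n)) = 1 \<and>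
        degree (w (Suc (Suc n))) = Suc n \<and> lead_coeff (w (Suc (Suc n))) = 1"
  proof (induction n)
    case (Suc n)
    define p where "p = [:-2, 1:] * w (Suc (Suc n))"
    have p: "degree p = Suc (Suc n)" "lead_coeff p = 1"
    proof -
      have "w (Suc (Suc n)) \<noteq> 0" using Suc.IH by (metis coeff_0 zero_neq_one)
      hence "degree p = Suc (degree (w (Suc (Suc n))))"
        unfolding p_def by (subst degree_mult_eq) auto
      thus "degree p = Suc (Suc n)" using Suc.IH by simp
      have "lead_coeff p = lead_coeff [:-2, 1:] * lead_coeff (w (Suc (Suc n)))"
        unfolding p_def by (rule lead_coeff_mult)
      also have "lead_coeff (w (Suc (Suc n))) = 1" using Suc.IH by blast
      finally show "lead_coeff p = 1" by simp
    qed
    have "w (Suc (Suc (Suc n))) = p + - w (Suc n)" by (simp add: p_def)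
    moreover have "degree (- w (Suc n)) < degree p" using Suc.IH p by simp
    ultimately have "degree (w (Suc (Suc (Suc n)))) = Suc (Suc n)"
      "lead_coeff (w (Suc (Suc (Suc n)))) = 1"
      using p lead_coeff_add_le[of "- w (Suc n)" p] degree_add_eq_left[of "- w (Suc n)" p]
      by (simp_all add: add.commute)
    thus ?case using Suc.IH by blast
  qed (simp add: one_pCons)
  thus ?thesis by blast
qed

text \<open>At x = 2 + y + 1/y the recursion has characteristic roots y and 1/y. This is its closed
  form (y^n + y^(1-n))/(y + 1) with denominators cleared; the zeros are thus given by y^(2n-1) = -1
  with y \<noteq> -1.\<close>

lemma poly_w_add_inverse:
  fixes y :: complex
  assumes "y \<noteq> 0"
  shows "poly (of_int_poly (w n)) (2 + y + inverse y) * y ^ n * (y + 1) = y ^ (2 * n) + y"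
proof (induction n rule: w.induct)
  case (3 n)
  define a where "a = poly (of_int_poly (w n)) (2 + y + inverse y)"
  define b where "b = poly (of_int_poly (w (Suc n))) (2 + y + inverse y)"
  have step: "poly (of_int_poly (w (Suc (Suc n)))) (2 + y + inverse y) = (y + inverse y) * b - a"
    by (simp add: a_def b_def hom_distribs algebra_simps)
  have "poly (of_int_poly (w (Suc (Suc n)))) (2 + y + inverse y) * y ^ Suc (Suc n) * (y + 1) =
    (y\<^sup>2 + 1) * (b * y ^ Suc n * (y + 1)) - y\<^sup>2 * (a * y ^ n * (y + 1))"
  proof -
    have "(y + inverse y) * y = y\<^sup>2 + 1" using assms by (simp add: distrib_right power2_eq_square)
    moreover have "(s * b - a) * y ^ Suc (Suc n) * (y + 1) =
      (s * y) * (b * y ^ Suc n * (y + 1)) - y\<^sup>2 * (a * y ^ n * (y + 1))" for s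
      by (simp add: power2_eq_square algebra_simps)
    ultimately show ?thesis using step by metis
  qed
  also have "\<dots> = (y\<^sup>2 + 1) * (y ^ (2 * Suc n) + y) - y\<^sup>2 * (y ^ (2 * n) + y)"
    using 3 by (simp only: a_def b_def)
  also have "\<dots> = y ^ (2 * Suc (Suc n)) + y"
    by (simp add: algebra_simps power2_eq_square)
  finally show ?case .
qed (simp_all add: algebra_simps power2_eq_square)

definition zeta :: "nat \<Rightarrow> complex" where
  "zeta d = cis (2 * pi / d)"

text \<open>For odd \<open>m\<close> and \<open>d\<close> the number \<open>-e\<^sup>i\<^sup>\<pi>\<^sup>m\<^sup>/\<^sup>d\<close> is the \<open>d\<close>-th root of unity \<open>\<zeta>\<^sup>k\<close> with \<open>2k = m + d\<close>, so the
  roots of \<open>\<Omega>\<^sub>d\<close> are values of \<open>\<tau>\<close> at roots of unity.\<close>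

definition tau :: "complex \<Rightarrow> complex" where
  "tau z = 2 - z - inverse z"

text \<open>For odd d > 1 this is the root set of \<open>Omega d\<close>. Letting k range over all
  numbers coprime to d repeats each root, but allows exponents to be multiplied without reduction
  modulo d.\<close>

definition conjugates :: "nat \<Rightarrow> complex set" where
  "conjugates d = (\<lambda>k. tau (zeta d ^ k)) ` {k. coprime k d}"

text \<open>The index set of the product \<open>Omega d\<close>: for odd d > 1 it represents each
  unit modulo d once up to sign.\<close>

definition odd_units :: "nat \<Rightarrow> nat set" where
  "odd_units d = {m. 1 \<le> m \<and> m < d \<and> odd m \<and> coprime m d}"

lemma zeta_nonzero [simp]: "zeta d \<noteq> 0"
  by (simp add: zeta_def)

lemma zeta_power_self: "d > 0 \<Longrightarrow> zeta d ^ d = 1"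
  by (simp add: zeta_def DeMoivre)

lemma zeta_power_eq_iff:
  assumes "d > 0"
  shows "zeta d ^ i = zeta d ^ j \<longleftrightarrow> [i = j] (mod d)"
proof
  assume eq: "zeta d ^ i = zeta d ^ j"
  have "inj_on (\<lambda>k. cis (2 * pi * real k / real d)) {..<d}"
    using bij_betw_roots_unity[OF assms] by (rule bij_betw_imp_inj_on)
  moreover have "cis (2 * pi * real k / real d) = zeta d ^ k" for k
    by (simp add: zeta_def DeMoivre mult_ac)
  ultimately have inj: "inj_on (\<lambda>k. zeta d ^ k) {..<d}" by simp
  have "zeta d ^ (i mod d) = zeta d ^ (j mod d)"
    using eq power_cong_root_of_unity[OF zeta_power_self[OF assms]] by (metis cong_mod_left cong_refl)
  hence "i mod d = j mod d" using inj_onD[OF inj] assms by simp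
  thus "[i = j] (mod d)" by (simp add: cong_def)
qed (rule power_cong_root_of_unity[OF zeta_power_self[OF assms]])

text \<open>Cleared of denominators, the difference of the two values factors as (u - v)(uv -
  1).\<close>

lemma tau_eq_iff:
  assumes "u \<noteq> 0" "v \<noteq> 0"
  shows "tau u = tau v \<longleftrightarrow> u = v \<or> u * v = 1"
proof -
  have "tau u = tau v \<longleftrightarrow> (u - v) * (u * v - 1) = 0"
  proof -
    have "(tau v - tau u) * (u * v) = (u - v) * (u * v - 1)"
      using assms by (simp add: tau_def algebra_simps)
    moreover have "u * v \<noteq> 0" using assms by simp
    ultimately show ?thesis by (metis eq_iff_diff_eq_0 mult_eq_0_iff)
  qed
  thus ?thesis by auto
qed

lemma tau_zeta_eq_iff:
  assumes "d > 0"
  shows "tau (zeta d ^ i) = tau (zeta d ^ j) \<longleftrightarrow> [i = j] (mod d) \<or> d dvd i + j"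
proof -
  have "zeta d ^ i * zeta d ^ j = 1 \<longleftrightarrow> zeta d ^ (i + j) = zeta d ^ 0"
    by (simp add: power_add)
  also have "\<dots> \<longleftrightarrow> d dvd i + j" unfolding zeta_power_eq_iff[OF assms] by (rule cong_0_iff)
  finally show ?thesis using zeta_power_eq_iff[OF assms] by (simp add: tau_eq_iff)
qed

lemma tau_minus_cis: "tau (- cis a) = of_real (2 + 2 * cos a)"
  by (simp add: tau_def complex_eq_iff)

lemma minus_cis_eq_zeta_power:
  assumes "odd m" "odd d"
  shows "- cis (pi * real m / real d) = zeta d ^ ((m + d) div 2)"
proof -
  have d: "d > 0" using assms(2) by (cases d) auto
  define k where "k = (m + d) div 2"
  define K where "K = real k"
  have "2 * k = m + d" using assms by (simp add: k_def)
  hence "real (2 * k) = real (m + d)" by (rule arg_cong)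
  hence K: "2 * K = real m + real d" unfolding K_def of_nat_mult of_nat_add by simp
  have "K * (2 * pi / d) = 2 * K * (pi / d)" by simp
  also have "\<dots> = pi * real m / real d + pi" unfolding K using d by (simp add: distrib_right)
  finally have "K * (2 * pi / d) = pi * real m / real d + pi" .
  thus ?thesis unfolding zeta_def DeMoivre minus_cis K_def k_def by simp
qed

text \<open>The values are 2 + 2 cos(\<pi> m/d) with angles in [0, \<pi>), where the cosine is
  injective.\<close>

lemma inj_on_tau_minus_cis: "inj_on (\<lambda>m. tau (- cis (pi * real m / real d))) {..<d}"
proof
  fix m n assume mn: "m \<in> {..<d}" "n \<in> {..<d}"
    "tau (- cis (pi * real m / real d)) = tau (- cis (pi * real n / real d))"
  hence "2 + 2 * cos (pi * real m / real d) = 2 + 2 * cos (pi * real n / real d)"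
    unfolding tau_minus_cis of_real_eq_iff by blast
  hence "cos (pi * real m / real d) = cos (pi * real n / real d)" by simp
  hence "pi * real m / real d = pi * real n / real d"
  proof (rule cos_inj_pi[rotated 4])
    have "pi * real i / real d \<le> pi" if "i < d" for i
      using that by (simp add: divide_le_eq)
    thus "pi * real m / real d \<le> pi" "pi * real n / real d \<le> pi" using mn(1,2) by simp_all
  qed simp_all
  thus "m = n" using mn(1,2) by simp
qed

text \<open>The relation 2k = m + d matches odd m with the k between d/2 and d. A smaller residue k
  is first reflected to d - k, which inverts the root of unity and leaves \<tau> unchanged.\<close>

lemma tau_image_odd_units:
  assumes d: "odd d" "d > 1"
  shows "(\<lambda>m. tau (- cis (pi * real m / real d))) ` odd_units d = conjugates d"
proof (intro equalityI subsetI)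
  fix x assume "x \<in> (\<lambda>m. tau (- cis (pi * real m / real d))) ` odd_units d"
  then obtain m where m: "odd m" "coprime m d" "x = tau (- cis (pi * real m / real d))"
    by (auto simp: odd_units_def)
  define k where "k = (m + d) div 2"
  have "2 * k = m + d" using m d by (simp add: k_def)
  hence "coprime (2 * k) d" using m(2) by (simp add: coprime_iff_gcd_eq_1)
  thus "x \<in> conjugates d"
    using minus_cis_eq_zeta_power[OF m(1) d(1)] m(3)
    by (auto simp: conjugates_def k_def)
next
  have upper: "tau (zeta d ^ k) \<in> (\<lambda>m. tau (- cis (pi * real m / real d))) ` odd_units d"
    if k: "coprime k d" "d < 2 * k" "k < d" for k
  proof -
    define m where "m = 2 * k - d"
    have m: "odd m" "2 * k = m + d" "m < d" using k d by (auto simp: m_def)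
    have "coprime 2 d" using d by simp
    hence "coprime (m + d) d" using k(1) m(2) by (metis coprime_mult_left_iff)
    hence "coprime m d" by (simp add: coprime_iff_gcd_eq_1)
    hence "m \<in> odd_units d" using m odd_pos[OF m(1)] by (simp add: odd_units_def)
    moreover have "(m + d) div 2 = k" using m(2) by simp
    hence "tau (zeta d ^ k) = tau (- cis (pi * real m / real d))"
      using minus_cis_eq_zeta_power[OF m(1) d(1)] by simp
    ultimately show ?thesis by blast
  qed
  fix x assume "x \<in> conjugates d"
  then obtain k0 where k0: "coprime k0 d" "x = tau (zeta d ^ k0)" by (auto simp: conjugates_def)
  define k where "k = k0 mod d"
  have k: "coprime k d" "k < d" using k0 d by (auto simp: k_def)
  have "[k = k0] (mod d)" by (simp add: k_def cong_def)
  hence x: "x = tau (zeta d ^ k)" using k0 d by (simp add: tau_zeta_eq_iff cong_sym)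
  show "x \<in> (\<lambda>m. tau (- cis (pi * real m / real d))) ` odd_units d"
  proof (cases "d < 2 * k")
    case True
    thus ?thesis using upper k x by blast
  next
    case False
    have "k \<noteq> 0" using k(1) d by (intro notI) auto
    moreover have "2 * k \<noteq> d" using d by auto
    moreover have "coprime (d - k) d"
      using k by (metis coprime_commute coprime_diff_one_left_nat gcd_diff2_nat coprime_iff_gcd_eq_1 less_imp_le gcd.commute)
    ultimately have "tau (zeta d ^ (d - k)) \<in> (\<lambda>m. tau (- cis (pi * real m / real d))) ` odd_units d"
      using False k by (intro upper) auto
    moreover have "x = tau (zeta d ^ (d - k))"
      unfolding x using k d by (simp add: tau_zeta_eq_iff)
    ultimately show ?thesis by simp
  qed
qed

lemma Omega_altdef: "Omega d = (\<Prod>m\<in>odd_units d. [:- tau (- cis (pi * real m / real d)), 1:])"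
  unfolding Omega_def odd_units_def
proof (intro prod.cong refl)
  fix m
  have "exp (- (\<i> * complex_of_real (pi * real m / real d))) = inverse (exp (\<i> * complex_of_real (pi * real m / real d)))"
    by (rule exp_minus)
  thus "[:- (exp (\<i> * complex_of_real (pi * real m / real d)) +
             exp (- (\<i> * complex_of_real (pi * real m / real d))) + 2), 1:] =
    [:- tau (- cis (pi * real m / real d)), 1:]"
    unfolding tau_def cis_conv_exp by (simp only: inverse_minus_eq) simp
qed

lemma finite_odd_units [simp]: "finite (odd_units d)"
  by (rule finite_subset[of _ "{..<d}"]) (auto simp: odd_units_def)

lemma inj_on_odd_units: "inj_on (\<lambda>m. tau (- cis (pi * real m / real d))) (odd_units d)"
  by (rule inj_on_subset[OF inj_on_tau_minus_cis]) (auto simp: odd_units_def)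

lemma finite_conjugates [simp]:
  assumes "odd d" "d > 1"
  shows "finite (conjugates d)"
  using tau_image_odd_units[OF assms] finite_odd_units[of d] by (metis finite_imageI)

lemma Omega_eq_prod_conjugates:
  assumes "odd d" "d > 1"
  shows "Omega d = (\<Prod>x\<in>conjugates d. [:- x, 1:])"
  unfolding Omega_altdef tau_image_odd_units[OF assms, symmetric]
  by (subst prod.reindex[OF inj_on_odd_units]) simp

text \<open>As d is odd, exactly one of m and d - m is odd, so reflection exchanges two halves of
  the totatives.\<close>

lemma card_odd_units:
  assumes d: "odd d" "d > 1"
  shows "2 * card (odd_units d) = totient d"
proof -
  have "totatives d = odd_units d \<union> (\<lambda>m. d - m) ` odd_units d"
  proof (intro equalityI subsetI)
    fix k assume k: "k \<in> totatives d"
    hence kd: "k < d" "k > 0" "coprime k d" using d totatives_less by (auto simp: in_totatives_iff)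
    have "coprime (d - k) d"
      using kd by (metis gcd_diff2_nat coprime_iff_gcd_eq_1 less_imp_le gcd.commute)
    thus "k \<in> odd_units d \<union> (\<lambda>m. d - m) ` odd_units d"
      using kd d by (cases "odd k") (auto simp: odd_units_def image_iff intro!: exI[of _ "d - k"])
  next
    fix k assume "k \<in> odd_units d \<union> (\<lambda>m. d - m) ` odd_units d"
    moreover have "coprime (d - m) d" if "coprime m d" "m < d" for m
      using that by (metis gcd_diff2_nat coprime_iff_gcd_eq_1 less_imp_le gcd.commute)
    ultimately show "k \<in> totatives d"
      by (auto simp: odd_units_def in_totatives_iff)
  qed
  moreover have "odd_units d \<inter> (\<lambda>m. d - m) ` odd_units d = {}"
    using d by (auto simp: odd_units_def)
  moreover have "card ((\<lambda>m. d - m) ` odd_units d) = card (odd_units d)"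
    by (intro card_image inj_onI) (auto simp: odd_units_def)
  ultimately have "card (totatives d) = card (odd_units d) + card (odd_units d)"
    by (simp add: card_Un_disjoint)
  thus ?thesis by (simp add: totient_def)
qed

lemma card_conjugates:
  assumes "odd d" "d > 1"
  shows "card (conjugates d) = totient d div 2"
  using card_odd_units[OF assms] card_image[OF inj_on_odd_units, of d]
  by (simp add: tau_image_odd_units[OF assms])

lemma degree_Omega:
  assumes "odd d" "d > 1"
  shows "degree (Omega d) = totient d div 2"
  using assms by (simp add: Omega_eq_prod_conjugates degree_prod_linear_factors card_conjugates)

lemma monic_Omega: "lead_coeff (Omega d) = 1"
  unfolding Omega_altdef by (rule monic_prod) simp

lemma poly_Omega_eq_0_iff:
  assumes "odd d" "d > 1"
  shows "poly (Omega d) x = 0 \<longleftrightarrow> x \<in> conjugates d"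
  using assms by (auto simp: Omega_eq_prod_conjugates poly_prod)

text \<open>With N = 2n - 1, reducing the fractions m/N with odd m < N to lowest terms groups them
  by denominators d > 1 dividing N. The resulting product of distinct linear factors divides
  \<open>w n\<close> by the closed form, and both are monic of degree n - 1.\<close>

lemma w_eq_prod_Omega:
  assumes n: "n \<ge> 1"
  shows "of_int_poly (w n) = (\<Prod>d | d dvd 2 * n - 1 \<and> d > 1. Omega d)"
proof -
  define N where "N = 2 * n - 1"
  define r where "r = (\<lambda>m d. tau (- cis (pi * real m / real d)))"
  define S where "S = {m. m < N \<and> odd m}"
  have N: "odd N" "N > 0" "N + 1 = 2 * n" using n by (auto simp: N_def)
  have fin: "finite S" by (simp add: S_def)
  have "(\<Prod>d | d dvd N \<and> d > 1. Omega d) =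
    (\<Prod>(d, m)\<in>(SIGMA d:{d. d dvd N \<and> d > 1}. odd_units d). [:- r m d, 1:])"
    unfolding Omega_altdef r_def
    using N(2) by (subst prod.Sigma) auto
  also have "\<dots> = (\<Prod>m\<in>S. [:- r m N, 1:])"
  proof (rule prod.reindex_bij_witness[where
        j = "\<lambda>(d, m). m * (N div d)" and i = "\<lambda>m. (N div gcd m N, m div gcd m N)"])
    fix m assume m: "m \<in> S"
    have g: "gcd m N > 0" using N by simp
    have dvd: "gcd m N dvd N" "gcd m N dvd m" by auto
    have m0: "m > 0" using m by (auto simp: S_def elim: oddE)
    have "N div gcd m N > 1"
    proof -
      have "gcd m N \<le> m" using m0 by (simp add: gcd_le1_nat)
      hence "gcd m N < N" using m by (simp add: S_def)
      thus ?thesis using dvd(1) N(2) by (metis One_nat_def Suc_lessI dvd_mult_div_cancel mult.right_neutral nat_less_le neq0_conv div_greater_zero_iff less_imp_le g)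
    qed
    moreover have "m div gcd m N < N div gcd m N" using m g dvd
      by (simp add: S_def div_less_iff_less_mult)
    moreover have "m div gcd m N \<ge> 1" using m0 g dvd by (simp add: dvd_imp_le Suc_le_eq div_greater_zero_iff)
    moreover have "odd (m div gcd m N)" using m dvd(2) by (metis S_def dvd_mult dvd_mult_div_cancel mem_Collect_eq)
    moreover have "coprime (m div gcd m N) (N div gcd m N)" using g by (simp add: div_gcd_coprime)
    moreover have "N div gcd m N dvd N" using dvd(1) by (metis dvd_mult_div_cancel dvd_triv_right)
    ultimately show "(N div gcd m N, m div gcd m N) \<in> (SIGMA d:{d. d dvd N \<and> d > 1}. odd_units d)"
      by (simp add: odd_units_def)
    show "(case (N div gcd m N, m div gcd m N) of (d, m) \<Rightarrow> m * (N div d)) = m"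
      using N g dvd by (simp add: div_div_eq_right)
  next
    fix x assume "x \<in> (SIGMA d:{d. d dvd N \<and> d > 1}. odd_units d)"
    then obtain d m where x: "x = (d, m)" "d dvd N" "d > 1" "m \<in> odd_units d" by auto
    obtain e where e: "N = d * e" using x(2) by (elim dvdE)
    have e0: "e > 0" "odd e" using e N by (auto intro: Nat.gr0I)
    have Nd: "N div d = e" using e x(3) by simp
    have m: "m < d" "odd m" "coprime m d" "m \<ge> 1" using x(4) by (auto simp: odd_units_def)
    have gcd: "gcd (m * e) N = e"
    proof -
      have "gcd (m * e) N = e * gcd m d" by (simp add: e gcd_mult_distrib_nat mult.commute)
      thus ?thesis using m(3) by (simp add: coprime_iff_gcd_eq_1)
    qed
    show "(case x of (d, m) \<Rightarrow> m * (N div d)) \<in> S"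
      using m e0 by (simp add: x(1) Nd S_def) (simp add: e)
    show "(N div gcd (case x of (d, m) \<Rightarrow> m * (N div d)) N,
      (case x of (d, m) \<Rightarrow> m * (N div d)) div gcd (case x of (d, m) \<Rightarrow> m * (N div d)) N) = x"
      using x(3) e0 by (simp add: x(1) Nd gcd) (simp add: e)
    have "real (m * e) / real N = real m / real d" using e0 x(3) by (simp add: e)
    hence "pi * real (m * e) / real N = pi * real m / real d" by (metis times_divide_eq_right)
    thus "[:- r (case x of (d, m) \<Rightarrow> m * (N div d)) N, 1:] = (case x of (d, m) \<Rightarrow> [:- r m d, 1:])"
      by (simp add: x(1) Nd r_def del: of_nat_mult)
  qed
  also have "\<dots> = of_int_poly (w n)"
  proof (rule monic_dvd_imp_eq)
    have inj: "inj_on (\<lambda>m. r m N) S"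
      unfolding r_def by (rule inj_on_subset[OF inj_on_tau_minus_cis]) (auto simp: S_def)
    have "poly (of_int_poly (w n)) (r m N) = 0" if m: "m \<in> S" for m
    proof -
      define y where "y = cis (pi * real m / real N)"
      have "y ^ N = cis (real m * pi)" using N by (simp add: y_def DeMoivre mult.commute)
      also have "\<dots> = -1" using m by (simp add: S_def cis.ctr complex_eq_iff)
      finally have "y ^ (2 * n) + y = 0" using N(3) by (metis add.right_inverse add_minus_cancel power_add power_one_right mult_minus1 add.commute)
      \<comment> \<open>The factor y + 1 of the closed form has to be cancelled; y = -1 would force
        m = N.\<close>
      moreover have "y \<noteq> -1"
      proof
        assume "y = -1"
        hence "cos (pi * real m / real N) = cos pi" by (simp add: y_def complex_eq_iff)
        hence "pi * real m / real N = pi"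
        proof (rule cos_inj_pi[rotated 4])
          show "pi * real m / real N \<le> pi" using m by (simp add: S_def divide_le_eq)
        qed simp_all
        hence "pi * real m = pi * real N" using N(2) by (simp add: divide_eq_eq)
        thus False using m by (simp add: S_def)
      qed
      moreover have "y \<noteq> 0" by (simp add: y_def)
      moreover have "r m N = 2 + y + inverse y" by (simp add: r_def y_def tau_def)
      ultimately show ?thesis using poly_w_add_inverse[of y n]
        by (simp add: eq_neg_iff_add_eq_0)
    qed
    hence "(\<Prod>x\<in>(\<lambda>m. r m N) ` S. [:- x, 1:]) dvd of_int_poly (w n)"
      using fin by (intro prod_linear_factors_dvd) auto
    thus "(\<Prod>m\<in>S. [:- r m N, 1:]) dvd of_int_poly (w n)"
      by (simp add: prod.reindex[OF inj])
    show "lead_coeff (\<Prod>m\<in>S. [:- r m N, 1:]) = 1" by (rule monic_prod) simp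
    obtain n' where n': "n = Suc n'" using n by (cases n) auto
    show "lead_coeff (of_int_poly (w n) :: complex poly) = 1" using conjunct1[OF monic_w, of n'] conjunct2[OF monic_w, of n'] by (simp add: n')
    have "S = (\<lambda>i. 2 * i + 1) ` {..<n'}"
      by (auto simp: S_def N_def n' image_iff elim!: oddE)
    hence "card S = n'" by (simp add: card_image inj_on_def)
    thus "degree (\<Prod>m\<in>S. [:- r m N, 1:]) = degree (of_int_poly (w n) :: complex poly)"
      using fin monic_w[of n'] by (simp add: degree_prod_linear_factors n')
  qed
  finally show ?thesis by (simp add: N_def)
qed

text \<open>Divide over the integers. The remainder is over \<complex> a multiple of g of smaller
  degree, hence zero, and the integral quotient must be q.\<close>

lemma monic_int_quotient:
  fixes g h :: "int poly"
  assumes "lead_coeff g = 1" "(of_int_poly h :: complex poly) = of_int_poly g * q"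
  obtains f where "of_int_poly f = q"
proof -
  obtain f r where fr: "h = g * f + r" "r = 0 \<or> degree r < degree g"
    using monic_division[OF assms(1)] by metis
  have "(of_int_poly r :: complex poly) = of_int_poly g * (q - of_int_poly f)"
    using assms(2) by (simp add: fr(1) hom_distribs algebra_simps)
  hence dvd: "(of_int_poly g :: complex poly) dvd of_int_poly r" by simp
  have "r = 0"
  proof (rule ccontr)
    assume "r \<noteq> 0"
    hence "(of_int_poly r :: complex poly) \<noteq> 0" by simp
    hence "degree (of_int_poly g :: complex poly) \<le> degree (of_int_poly r :: complex poly)"
      using dvd by (intro dvd_imp_degree_le)
    thus False using fr(2) \<open>r \<noteq> 0\<close> by simp
  qed
  hence "(of_int_poly g :: complex poly) * of_int_poly f = of_int_poly g * q"
    using assms(2) by (simp add: fr(1) hom_distribs)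
  moreover have "(of_int_poly g :: complex poly) \<noteq> 0" using assms(1) by auto
  ultimately have "of_int_poly f = q" by simp
  thus ?thesis by (rule that)
qed

text \<open>Strong induction: with d = 2n - 1, \<open>Omega d\<close> is the quotient of
  \<open>w n\<close> by the product of the \<open>Omega e\<close> for the smaller divisors e > 1 of
  d, which is monic and already integral.\<close>

lemma Omega_integral:
  assumes "odd d" "d > 1"
  obtains f :: "int poly" where "of_int_poly f = Omega d"
proof -
  have "\<exists>f::int poly. of_int_poly f = Omega d"
    using assms
  proof (induction d rule: less_induct)
    case (less d)
    obtain k where k: "d = 2 * k + 1" using less.prems(1) by (rule oddE)
    define n where "n = k + 1"
    have n: "2 * n - 1 = d" "n \<ge> 1" unfolding n_def k by simp_all
    define E where "E = {e. e dvd d \<and> e > 1} - {d}"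
    have "\<exists>f::int poly. of_int_poly f = Omega e" if e: "e \<in> E" for e
    proof (rule less.IH)
      have "e \<le> d" "e \<noteq> d" using e less.prems dvd_imp_le[of e d] by (auto simp: E_def)
      thus "e < d" by simp
      show "odd e" using e less.prems by (auto simp: E_def)
      show "e > 1" using e by (simp add: E_def)
    qed
    then obtain F :: "nat \<Rightarrow> int poly" where F: "\<And>e. e \<in> E \<Longrightarrow> of_int_poly (F e) = Omega e"
      by metis
    define g where "g = (\<Prod>e\<in>E. F e)"
    have g: "(of_int_poly g :: complex poly) = (\<Prod>e\<in>E. Omega e)"
      unfolding g_def of_int_poly_hom.hom_prod using F by simp
    have "lead_coeff (of_int_poly g :: complex poly) = 1"
      unfolding g using monic_Omega by (intro monic_prod)
    hence lc: "lead_coeff g = 1" by simp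
    have "{e. e dvd d \<and> e > 1} = insert d E" using less.prems by (auto simp: E_def)
    moreover have "finite {e. e dvd d \<and> e > 1}"
      using less.prems by (intro finite_subset[OF _ finite_divisors_nat[of d]]) auto
    hence "finite E" by (simp add: E_def)
    moreover have "d \<notin> E" by (simp add: E_def)
    ultimately have "(of_int_poly (w n) :: complex poly) = of_int_poly g * Omega d"
      using w_eq_prod_Omega[OF n(2)] unfolding n(1) by (simp add: g mult.commute)
    from monic_int_quotient[OF lc this] show ?case by metis
  qed
  thus ?thesis using that by blast
qed

section \<open>Irreducibility of \<open>Omega d\<close> and the irreducible factors of
  \<open>w n\<close>\<close>

interpretation of_rat_poly_hom: map_poly_inj_idom_hom "of_rat :: rat \<Rightarrow> complex" ..

lemma of_rat_poly_of_int_poly: "map_poly of_rat (of_int_poly f :: rat poly) = (of_int_poly f :: complex poly)"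
  by (simp add: map_poly_map_poly o_def)

text \<open>On n-th roots of unity \<tau> agrees with the polynomial 2 - X - X^(n-1); composing h
  with it reduces the claim to \<open>root_of_unity_conjugate\<close>.\<close>

lemma tau_conjugate:
  assumes z: "z ^ n = (1::complex)" "n > 0" and k: "coprime k n"
    and h: "poly (map_poly of_rat h) (tau z) = 0"
  shows "poly (map_poly of_rat h) (tau (z ^ k)) = 0"
proof -
  define t :: "rat poly" where "t = [:2, -1:] - monom 1 (n - 1)"
  have t: "poly (map_poly of_rat t) u = tau u" if "u ^ n = 1" for u :: complex
  proof -
    have "u * u ^ (n - 1) = 1" using that z(2) by (simp flip: power_Suc)
    hence "u ^ (n - 1) = inverse u" by (metis inverse_unique)
    thus ?thesis by (simp add: t_def tau_def hom_distribs poly_monom)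
  qed
  have comp: "poly (map_poly of_rat (h \<circ>\<^sub>p t)) u = poly (map_poly of_rat h) (tau u)" if "u ^ n = 1" for u :: complex
    using t[OF that] by (simp add: of_rat_hom.map_poly_pcompose poly_pcompose)
  have "poly (map_poly of_rat (h \<circ>\<^sub>p t)) (z ^ k) = 0"
    using h by (intro root_of_unity_conjugate[OF z k]) (simp add: comp z)
  moreover have "(z ^ k) ^ n = 1" using z(1) by (metis mult.commute power_mult power_one)
  ultimately show ?thesis using comp by metis
qed

lemma inverse_mod:
  fixes k d :: nat
  assumes "coprime k d"
  obtains l where "coprime l d" "[k * l = 1] (mod d)"
proof -
  obtain l where l: "[k * l = 1] (mod d)" using cong_solve_coprime_nat[OF assms] by auto
  hence "coprime (k * l) d" using cong_imp_coprime[OF cong_sym] by (metis coprime_1_left)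
  hence "coprime l d" by simp
  thus ?thesis using l by (rule that)
qed

text \<open>With l inverse to k modulo d, raising \<zeta>^k to the power lj gives \<zeta>^j.\<close>

lemma conjugates_common_root:
  assumes d: "odd d" "d > 1" and xy: "x \<in> conjugates d" "y \<in> conjugates d"
    and h: "poly (map_poly of_rat h) x = 0"
  shows "poly (map_poly of_rat h) y = 0"
proof -
  have z: "zeta d ^ d = 1" "d > 0" using d zeta_power_self by auto
  obtain k j where kj: "coprime k d" "x = tau (zeta d ^ k)" "coprime j d" "y = tau (zeta d ^ j)"
    using xy by (auto simp: conjugates_def)
  obtain l where l: "coprime l d" "[k * l = 1] (mod d)" using inverse_mod[OF kj(1)] .
  have "(zeta d ^ k) ^ d = 1" using z(1) by (metis mult.commute power_mult power_one)
  hence "poly (map_poly of_rat h) (tau ((zeta d ^ k) ^ (l * j))) = 0"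
    using h l(1) kj by (intro tau_conjugate[OF _ z(2), of "zeta d ^ k"]) simp_all
  moreover have "[k * (l * j) = 1 * j] (mod d)"
    using l(2) by (metis cong_scalar_right mult.assoc)
  hence "(zeta d ^ k) ^ (l * j) = zeta d ^ j"
    using zeta_power_eq_iff[OF z(2)] by (simp flip: power_mult)
  ultimately show ?thesis using kj by simp
qed

lemma tau_zeta_in_conjugates [intro]: "tau (zeta d) \<in> conjugates d"
  unfolding conjugates_def by (rule image_eqI[of _ _ 1]) auto

text \<open>A rational polynomial vanishing at one conjugate vanishes at all of them, so
  \<open>Omega d\<close> divides it. Irreducibility and the independence of powers both rest on this
  bound.\<close>

lemma Omega_minimal:
  assumes d: "odd d" "d > 1" and x: "x \<in> conjugates d"
    and h: "poly (map_poly of_rat h) x = 0" "h \<noteq> 0"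
  shows "totient d div 2 \<le> degree h"
proof -
  have "Omega d dvd map_poly of_rat h"
    unfolding Omega_eq_prod_conjugates[OF d]
    using d conjugates_common_root[OF d x _ h(1)] by (intro prod_linear_factors_dvd) auto
  hence "degree (Omega d) \<le> degree (map_poly of_rat h :: complex poly)"
    using h(2) by (intro dvd_imp_degree_le) auto
  thus ?thesis using degree_Omega[OF d] by simp
qed

text \<open>In any factorization the factor vanishing at \<tau>(\<zeta>) already has the full
  degree.\<close>

lemma Omega_irreducible:
  assumes d: "odd d" "d > 1" and f: "of_int_poly f = Omega d"
  shows "irreducible (of_int_poly f :: rat poly)"
proof (rule irreducibleI)
  let ?F = "of_int_poly f :: rat poly"
  have F: "map_poly of_rat ?F = Omega d" using f by (simp add: of_rat_poly_of_int_poly)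
  have deg: "degree ?F = totient d div 2"
    using degree_Omega[OF d] unfolding F[symmetric] by simp
  have root: "poly (map_poly of_rat ?F) (tau (zeta d)) = 0"
    unfolding F using tau_zeta_in_conjugates by (simp add: poly_Omega_eq_0_iff[OF d])
  show nz: "?F \<noteq> 0" using F monic_Omega[of d] by auto
  show "\<not> is_unit ?F"
  proof
    assume "is_unit ?F"
    hence "degree ?F = 0" using is_unit_iff_degree[OF nz] by blast
    then obtain c where "?F = [:c:]" by (rule degree_eq_zeroE)
    thus False using root nz by simp
  qed
  fix a b assume ab: "?F = a * b"
  hence nz': "a \<noteq> 0" "b \<noteq> 0" using nz by auto
  have "poly (map_poly of_rat a) (tau (zeta d)) = 0 \<or> poly (map_poly of_rat b) (tau (zeta d)) = 0"
    using root unfolding ab by (simp add: hom_distribs)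
  hence "degree ?F \<le> degree a \<or> degree ?F \<le> degree b"
    using Omega_minimal[OF d tau_zeta_in_conjugates] nz' deg by auto
  hence "degree a = 0 \<or> degree b = 0" using nz' by (auto simp: ab degree_mult_eq)
  thus "is_unit a \<or> is_unit b" using nz' by (simp add: is_unit_iff_degree)
qed

lemma Omega_int_monic_irreducible:
  assumes "odd d" "d > 1" "of_int_poly f = Omega d"
  shows "monic_irreducible f"
proof -
  have "lead_coeff (of_int_poly f :: complex poly) = 1" unfolding assms(3) by (rule monic_Omega)
  thus ?thesis using Omega_irreducible[OF assms] by (simp add: monic_irreducible_def)
qed

text \<open>The divisibility is phrased over the integers for the sake of n = 0: there 2n - 1 is -1,
  without divisors above 1, in agreement with \<open>w 0 = 1\<close>, whereas truncated subtraction
  would give 0.\<close>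

theorem irreducible_factors_w:
  "map_poly of_rat ` {g :: rat poly. lead_coeff g = 1 \<and> irreducible g \<and> g dvd of_int_poly (w n)}
    = Omega ` {d. d > 1 \<and> int d dvd 2 * int n - 1}"
proof (cases "n = 0")
  case True
  have "{g :: rat poly. lead_coeff g = 1 \<and> irreducible g \<and> g dvd of_int_poly (w n)} = {}"
    using True by (auto simp: irreducible_def)
  moreover have "{d. d > 1 \<and> int d dvd 2 * int n - 1} = {}" using True by auto
  ultimately show ?thesis by (simp only: image_empty)
next
  case False
  define D where "D = {d. d dvd 2 * n - 1 \<and> d > 1}"
  have "int (2 * n - 1) = 2 * int n - 1" using False by (simp add: of_nat_diff)
  hence D: "{d. d > 1 \<and> int d dvd 2 * int n - 1} = D"
    unfolding D_def by (metis (no_types, lifting) Collect_cong conj_commute int_dvd_int_iff)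
  have odd: "odd d \<and> d > 1" if "d \<in> D" for d
  proof -
    have "odd (2 * n - 1)" using False by simp
    thus ?thesis using that dvd_trans unfolding D_def by blast
  qed
  have "finite D" using False unfolding D_def
    by (intro finite_subset[OF _ finite_divisors_nat[of "2 * n - 1"]]) auto
  have "\<forall>d\<in>D. \<exists>f::int poly. of_int_poly f = Omega d" using Omega_integral odd by metis
  then obtain F :: "nat \<Rightarrow> int poly" where F: "\<And>d. d \<in> D \<Longrightarrow> of_int_poly (F d) = Omega d"
    by metis
  have "(of_int_poly (w n) :: complex poly) = of_int_poly (\<Prod>d\<in>D. F d)"
    unfolding of_int_poly_hom.hom_prod using w_eq_prod_Omega[of n] False F by (simp add: D_def)
  hence "w n = (\<Prod>d\<in>D. F d)" by simp
  hence W: "(of_int_poly (w n) :: rat poly) = (\<Prod>d\<in>D. of_int_poly (F d))"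
    by (simp add: of_int_poly_hom.hom_prod)
  have irr: "irreducible (of_int_poly (F d) :: rat poly)" and monic: "lead_coeff (F d) = 1" if "d \<in> D" for d
    using Omega_int_monic_irreducible[of d "F d"] odd[OF that] F[OF that]
    by (auto simp: monic_irreducible_def)
  have "{g :: rat poly. lead_coeff g = 1 \<and> irreducible g \<and> g dvd of_int_poly (w n)} =
    (\<lambda>d. of_int_poly (F d)) ` D"
  proof (intro equalityI subsetI)
    fix g :: "rat poly" assume "g \<in> {g. lead_coeff g = 1 \<and> irreducible g \<and> g dvd of_int_poly (w n)}"
    hence g: "lead_coeff g = 1" "irreducible g" "g dvd (\<Prod>d\<in>D. of_int_poly (F d))"
      using W by auto
    have "prime_elem g" using g(2) by (rule field_poly_irreducible_imp_prime)
    have "\<exists>d\<in>D. g dvd of_int_poly (F d)"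
      using \<open>finite D\<close> g(3)
    proof (induction D rule: finite_induct)
      case empty
      thus ?case using g(2) by (simp add: irreducible_def)
    next
      case (insert x A)
      thus ?case using \<open>prime_elem g\<close> by (auto simp: prime_elem_dvd_mult_iff)
    qed
    then obtain d where d: "d \<in> D" "g dvd of_int_poly (F d)" by blast
    then obtain h where h: "of_int_poly (F d) = g * h" by (elim dvdE)
    have "is_unit h" using irr[OF d(1)] g(2) h unfolding irreducible_def by blast
    hence "degree h = 0" by (auto simp: is_unit_poly_iff)
    moreover have "g * h \<noteq> 0" using irr[OF d(1)] h by (auto simp: irreducible_def)
    ultimately have "degree g = degree (of_int_poly (F d) :: rat poly)"
      unfolding h by (simp add: degree_mult_eq)
    hence "g = of_int_poly (F d)"
      using d(2) g(1) monic[OF d(1)] by (intro monic_dvd_imp_eq) auto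
    thus "g \<in> (\<lambda>d. of_int_poly (F d)) ` D" using d(1) by blast
  next
    fix g :: "rat poly" assume "g \<in> (\<lambda>d. of_int_poly (F d)) ` D"
    then obtain d where d: "d \<in> D" "g = of_int_poly (F d)" by blast
    have "g dvd of_int_poly (w n)" unfolding W d(2) by (rule dvd_prodI[OF \<open>finite D\<close> d(1)])
    thus "g \<in> {g. lead_coeff g = 1 \<and> irreducible g \<and> g dvd of_int_poly (w n)}"
      using irr[OF d(1)] monic[OF d(1)] by (simp add: d(2))
  qed
  also have "map_poly of_rat ` ((\<lambda>d. of_int_poly (F d)) ` D) = Omega ` D"
    unfolding image_image of_rat_poly_of_int_poly using F by (intro image_cong) auto
  finally show ?thesis unfolding D .
qed

section \<open>The real cyclotomic fields and their integers\<close>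

lemma complex_ring_simps [simp]:
  "carrier (ring_of_type_algebra :: complex ring) = UNIV"
  "x \<otimes>\<^bsub>ring_of_type_algebra\<^esub> y = x * (y::complex)"
  "x \<oplus>\<^bsub>ring_of_type_algebra\<^esub> y = x + (y::complex)"
  "\<one>\<^bsub>ring_of_type_algebra\<^esub> = (1::complex)"
  "\<zero>\<^bsub>ring_of_type_algebra\<^esub> = (0::complex)"
  by (simp_all add: ring_of_type_algebra_def)

lemma complex_ring_uminus [simp]: "\<ominus>\<^bsub>ring_of_type_algebra\<^esub> x = - (x::complex)"
proof -
  interpret ring "ring_of_type_algebra :: complex ring" by (rule ring_from_type_algebra)
  show ?thesis by (rule minus_equality) auto
qed

lemma complex_ring_inv: "x \<noteq> 0 \<Longrightarrow> inv\<^bsub>ring_of_type_algebra\<^esub> x = inverse (x::complex)"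
proof -
  interpret cring "ring_of_type_algebra :: complex ring" by (rule cring_from_type_algebra)
  show "x \<noteq> 0 \<Longrightarrow> ?thesis" by (rule comm_inv_char) auto
qed

lemma Q_adjoin_incl: "x \<in> S \<Longrightarrow> x \<in> Q_adjoin S"
  unfolding Q_adjoin_def by (rule generate_field.incl)

lemma Q_adjoin_1: "1 \<in> Q_adjoin S"
  unfolding Q_adjoin_def using generate_field.one[of "ring_of_type_algebra :: complex ring"] by simp

lemma Q_adjoin_uminus: "x \<in> Q_adjoin S \<Longrightarrow> - x \<in> Q_adjoin S"
  unfolding Q_adjoin_def using generate_field.a_inv[of x "ring_of_type_algebra :: complex ring"] by simp

lemma Q_adjoin_inverse: "x \<in> Q_adjoin S \<Longrightarrow> x \<noteq> 0 \<Longrightarrow> inverse x \<in> Q_adjoin S"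
  unfolding Q_adjoin_def using generate_field.m_inv[of x "ring_of_type_algebra :: complex ring"]
  by (simp add: complex_ring_inv)

lemma Q_adjoin_add: "x \<in> Q_adjoin S \<Longrightarrow> y \<in> Q_adjoin S \<Longrightarrow> x + y \<in> Q_adjoin S"
  unfolding Q_adjoin_def using generate_field.eng_add[of x "ring_of_type_algebra :: complex ring"] by simp

lemma Q_adjoin_mult: "x \<in> Q_adjoin S \<Longrightarrow> y \<in> Q_adjoin S \<Longrightarrow> x * y \<in> Q_adjoin S"
  unfolding Q_adjoin_def using generate_field.eng_mult[of x "ring_of_type_algebra :: complex ring"] by simp

lemma Q_adjoin_0: "0 \<in> Q_adjoin S"
  using Q_adjoin_add[OF Q_adjoin_1 Q_adjoin_uminus[OF Q_adjoin_1]] by simp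

lemma Q_adjoin_of_nat: "of_nat n \<in> Q_adjoin S"
  by (induction n) (auto intro: Q_adjoin_0 Q_adjoin_1 Q_adjoin_add)

lemma Q_adjoin_of_int: "of_int n \<in> Q_adjoin S"
  by (cases n rule: int_cases2) (auto intro: Q_adjoin_of_nat Q_adjoin_uminus)

lemma Q_adjoin_of_rat: "of_rat q \<in> Q_adjoin S"
proof -
  obtain a b where q: "q = of_int a / of_int b" "b > 0"
    by (metis quotient_of_denom_pos quotient_of_div surj_pair)
  have "of_rat q = of_int a / (of_int b :: complex)"
    unfolding q(1) of_rat_divide by simp
  hence "of_rat q = of_int a * inverse (of_int b :: complex)"
    by (simp only: divide_inverse)
  thus ?thesis using q(2) by (auto intro!: Q_adjoin_mult Q_adjoin_of_int Q_adjoin_inverse)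
qed

lemma Q_adjoin_poly: "x \<in> Q_adjoin S \<Longrightarrow> poly (map_poly of_rat A) x \<in> Q_adjoin S"
  by (induction A) (auto intro: Q_adjoin_0 Q_adjoin_add Q_adjoin_mult Q_adjoin_of_rat
      simp: of_rat_hom.map_poly_pCons_hom)

lemma Q_adjoin_least:
  assumes "S \<subseteq> Q_adjoin T"
  shows "Q_adjoin S \<subseteq> Q_adjoin T"
proof
  fix x assume "x \<in> Q_adjoin S"
  thus "x \<in> Q_adjoin T"
    unfolding Q_adjoin_def[of S]
  proof (induction rule: generate_field.induct)
    case (m_inv h)
    thus ?case by (auto simp: complex_ring_inv intro: Q_adjoin_inverse)
  qed (use assms in \<open>auto intro: Q_adjoin_1 Q_adjoin_uminus Q_adjoin_add Q_adjoin_mult\<close>)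
qed

text \<open>The point is closure under inverses: a nonzero h has an integral multiple y in
  \<int>[\<theta>], and y C(y) = c with a nonzero integer c makes 1/h a polynomial in
  \<theta>.\<close>

lemma Q_adjoin_algebraic_int:
  assumes \<theta>: "\<And>x. x \<in> Z_adjoin \<theta> \<Longrightarrow> algebraic_int x"
  shows "Q_adjoin {\<theta>} = range (\<lambda>A. poly (map_poly of_rat A) \<theta>)" (is "_ = ?K")
proof (intro equalityI subsetI)
  fix x assume "x \<in> ?K"
  thus "x \<in> Q_adjoin {\<theta>}" by (auto intro: Q_adjoin_poly Q_adjoin_incl)
next
  fix x assume "x \<in> Q_adjoin {\<theta>}"
  thus "x \<in> ?K"
    unfolding Q_adjoin_def
  proof (induction rule: generate_field.induct)
    case one
    show ?case by (rule image_eqI[of _ _ 1]) auto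
  next
    case (incl h)
    thus ?case by (intro image_eqI[of _ _ "[:0, 1:]"]) (auto simp: of_rat_hom.map_poly_pCons_hom)
  next
    case (a_inv h)
    then obtain A where "h = poly (map_poly of_rat A) \<theta>" by blast
    thus ?case by (intro image_eqI[of _ _ "- A"]) (auto simp: of_rat_poly_hom.hom_uminus)
  next
    case (eng_add g h)
    then obtain A B where "g = poly (map_poly of_rat A) \<theta>" "h = poly (map_poly of_rat B) \<theta>" by blast
    thus ?case by (intro image_eqI[of _ _ "A + B"]) (auto simp: hom_distribs)
  next
    case (eng_mult g h)
    then obtain A B where "g = poly (map_poly of_rat A) \<theta>" "h = poly (map_poly of_rat B) \<theta>" by blast
    thus ?case by (intro image_eqI[of _ _ "A * B"]) (auto simp: hom_distribs)
  next
    case (m_inv h)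
    then obtain A where A: "h = poly (map_poly of_rat A) \<theta>" by blast
    obtain D B where DB: "D > 0"
      "\<And>x::complex. of_int D * poly (map_poly of_rat A) x = poly (of_int_poly B) x"
      using clear_denominators by blast
    define y where "y = poly (of_int_poly B) \<theta>"
    have y: "y = of_int D * h" using DB(2) by (simp add: y_def A)
    have "y \<noteq> 0" using DB(1) m_inv.hyps(2) by (simp add: y)
    moreover have "y \<in> Z_adjoin \<theta>" unfolding y_def by auto
    ultimately obtain c C where c: "c \<noteq> 0" "y * poly (of_int_poly C) y = of_int c"
      using algebraic_int_dvd_int \<theta> by metis
    have "inverse h = of_int D / of_int c * poly (of_int_poly C) y"
    proof (rule inverse_unique)
      show "h * (of_int D / of_int c * poly (of_int_poly C) y) = 1"
        using c by (simp add: y field_simps)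
    qed
    also have "\<dots> = of_rat (of_int D / of_int c) * poly (map_poly of_rat (of_int_poly (C \<circ>\<^sub>p B))) \<theta>"
      unfolding of_rat_poly_of_int_poly
      by (simp add: of_rat_divide of_int_hom.map_poly_pcompose poly_pcompose y_def)
    also have "\<dots> = poly (map_poly of_rat (smult (of_int D / of_int c) (of_int_poly (C \<circ>\<^sub>p B)))) \<theta>"
      by (simp only: of_rat_hom.map_poly_hom_smult poly_smult)
    finally show ?case using m_inv.hyps(2) by (simp add: complex_ring_inv)
  qed
qed

text \<open>Up to affine changes of variables, \<open>C\<close> is the \<open>l\<close>-th Chebyshev polynomial.\<close>

lemma tau_power:
  obtains C :: "int poly" where "\<And>u. u \<noteq> 0 \<Longrightarrow> tau (u ^ l) = poly (of_int_poly C) (tau u)"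
proof -
  have "\<exists>C::int poly. \<forall>u. u \<noteq> 0 \<longrightarrow> u ^ l + inverse u ^ l = poly (of_int_poly C) (tau u)"
  proof (induction l rule: induct_nat_012)
    case 0
    show ?case by (rule exI[of _ "[:2:]"]) simp
  next
    case 1
    show ?case by (rule exI[of _ "[:2, -1:]"]) (simp add: tau_def)
  next
    case (ge2 n)
    then obtain B C :: "int poly" where BC:
      "\<And>u. u \<noteq> 0 \<Longrightarrow> u ^ n + inverse u ^ n = poly (of_int_poly B) (tau u)"
      "\<And>u. u \<noteq> 0 \<Longrightarrow> u ^ Suc n + inverse u ^ Suc n = poly (of_int_poly C) (tau u)"
      by blast
    have "u ^ Suc (Suc n) + inverse u ^ Suc (Suc n) = poly (of_int_poly ([:2, -1:] * C - B)) (tau u)"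
      if u: "u \<noteq> 0" for u
    proof -
      have v: "u * inverse u = 1" using u by simp
      have "(u + v) * (u ^ Suc n + v ^ Suc n) - (u ^ n + v ^ n) = u ^ Suc (Suc n) + v ^ Suc (Suc n)"
        if "u * v = 1" for v :: complex
      proof -
        have "(u + v) * (u ^ Suc n + v ^ Suc n) =
          u ^ Suc (Suc n) + v ^ Suc (Suc n) + (u * v) * u ^ n + (u * v) * v ^ n"
          by (simp add: algebra_simps)
        thus ?thesis using that by simp
      qed
      moreover have "poly (of_int_poly ([:2, -1:] * C - B)) (tau u) =
          (2 - tau u) * poly (of_int_poly C) (tau u) - poly (of_int_poly B) (tau u)"
        unfolding of_int_poly_hom.hom_minus of_int_poly_hom.hom_mult poly_diff poly_mult by simp
      moreover have "2 - tau u = u + inverse u" by (simp add: tau_def)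
      ultimately show ?thesis using v BC[OF u] by metis
    qed
    thus ?case by blast
  qed
  then obtain C :: "int poly" where
    C: "\<And>u. u \<noteq> 0 \<Longrightarrow> u ^ l + inverse u ^ l = poly (of_int_poly C) (tau u)" by blast
  have "tau (u ^ l) = poly (of_int_poly (2 - C)) (tau u)" if "u \<noteq> 0" for u
    using C[OF that, symmetric] by (simp add: tau_def hom_distribs power_inverse)
  thus ?thesis by (rule that)
qed

text \<open>As k is invertible modulo d, \<zeta>^j is a power of \<zeta>^k, and \<tau> of a power is
  an integer polynomial in \<tau>. By symmetry all conjugates generate the same ring and the same
  field.\<close>

lemma conjugates_in_Z_adjoin:
  assumes d: "d > 0" and x: "x \<in> conjugates d" and y: "y \<in> conjugates d"
  shows "y \<in> Z_adjoin x"
proof -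
  obtain k j where kj: "coprime k d" "x = tau (zeta d ^ k)" "coprime j d" "y = tau (zeta d ^ j)"
    using x y by (auto simp: conjugates_def)
  obtain l where l: "[k * l = 1] (mod d)" using inverse_mod[OF kj(1)] by metis
  have "[k * (l * j) = 1 * j] (mod d)"
    using l by (metis cong_scalar_right mult.assoc)
  hence "(zeta d ^ k) ^ (l * j) = zeta d ^ j"
    using zeta_power_eq_iff[OF d] by (simp flip: power_mult)
  moreover obtain C :: "int poly" where
    "\<And>u. u \<noteq> 0 \<Longrightarrow> tau (u ^ (l * j)) = poly (of_int_poly C) (tau u)" using tau_power by blast
  ultimately have "y = poly (of_int_poly C) x" using kj by (metis power_not_zero zeta_nonzero)
  thus ?thesis by (rule Z_adjoinI)
qed

lemma tau_zeta_in_Z_adjoin_zeta: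
  assumes "d > 0"
  shows "tau (zeta d) \<in> Z_adjoin (zeta d)"
proof -
  have "zeta d * zeta d ^ (d - 1) = 1" using zeta_power_self[OF assms] assms by (simp flip: power_Suc)
  hence "tau (zeta d) = 2 - zeta d - zeta d ^ (d - 1)" unfolding tau_def by (metis inverse_unique)
  also have "\<dots> \<in> Z_adjoin (zeta d)" by auto
  finally show ?thesis .
qed

lemma Z_adjoin_conjugate:
  assumes "d > 0" "x \<in> conjugates d"
  shows "Z_adjoin x = Z_adjoin (tau (zeta d))"
  using conjugates_in_Z_adjoin[OF assms(1)] assms(2) tau_zeta_in_conjugates
  by (intro equalityI Z_adjoin_subset) auto

lemma Z_adjoin_conjugate_subset:
  assumes "d > 0" "x \<in> conjugates d"
  shows "Z_adjoin x \<subseteq> Z_adjoin (zeta d)"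
  unfolding Z_adjoin_conjugate[OF assms] by (rule Z_adjoin_subset[OF tau_zeta_in_Z_adjoin_zeta[OF assms(1)]])

lemma algebraic_int_Z_adjoin_conjugate:
  assumes "d > 0" "x \<in> conjugates d" "y \<in> Z_adjoin x"
  shows "algebraic_int y"
  using algebraic_int_Z_adjoin[OF zeta_power_self] Z_adjoin_conjugate_subset[OF assms(1,2)] assms by blast

lemma Q_adjoin_conjugate_eq:
  assumes "d > 0" "x \<in> conjugates d"
  shows "Q_adjoin {x} = range (\<lambda>A. poly (map_poly of_rat A) x)"
  by (rule Q_adjoin_algebraic_int) (rule algebraic_int_Z_adjoin_conjugate[OF assms])

lemma Z_adjoin_subset_Q_adjoin: "Z_adjoin x \<subseteq> Q_adjoin {x}"
proof
  fix y assume "y \<in> Z_adjoin x"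
  then obtain A where "y = poly (map_poly of_rat (of_int_poly A)) x"
    unfolding of_rat_poly_of_int_poly by (rule Z_adjoinE)
  thus "y \<in> Q_adjoin {x}" using Q_adjoin_poly[OF Q_adjoin_incl] by blast
qed

lemma Q_adjoin_conjugate:
  assumes "d > 0" "x \<in> conjugates d"
  shows "Q_adjoin {x} = Q_adjoin {tau (zeta d)}"
proof -
  have "y \<in> Q_adjoin {x}" if "x \<in> conjugates d" "y \<in> conjugates d" for x y
    using conjugates_in_Z_adjoin[OF assms(1) that] Z_adjoin_subset_Q_adjoin by blast
  thus ?thesis using assms(2) tau_zeta_in_conjugates by (intro equalityI Q_adjoin_least) auto
qed

lemma Q_adjoin_conjugates:
  assumes "d > 0"
  shows "Q_adjoin (conjugates d) = Q_adjoin {tau (zeta d)}"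
proof (intro equalityI Q_adjoin_least)
  show "conjugates d \<subseteq> Q_adjoin {tau (zeta d)}"
    using conjugates_in_Z_adjoin[OF assms tau_zeta_in_conjugates] Z_adjoin_subset_Q_adjoin by blast
  show "{tau (zeta d)} \<subseteq> Q_adjoin (conjugates d)"
    using tau_zeta_in_conjugates by (auto intro: Q_adjoin_incl)
qed

section \<open>Descent from \<int>[\<zeta>] to \<int>[\<tau>] and monogenicity\<close>

lemma Im_zeta_nonzero:
  assumes "d > 2"
  shows "Im (zeta d) \<noteq> 0"
proof -
  have "2 * pi / real d < pi" using assms by (simp add: divide_less_eq)
  hence "sin (2 * pi / real d) > 0" using assms by (intro sin_gt_zero) auto
  thus ?thesis by (simp add: zeta_def)
qed

lemma tau_zeta_real: "tau (zeta d) \<in> \<real>"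
  by (simp add: complex_is_Real_iff tau_def zeta_def)

lemma Reals_poly_of_int: "x \<in> \<real> \<Longrightarrow> poly (of_int_poly A) (x::complex) \<in> \<real>"
  by (induction A) auto

text \<open>\<zeta> satisfies the monic quadratic equation \<zeta>^2 = (2 - \<tau>) \<zeta> - 1 over
  \<int>[\<tau>].\<close>

lemma Z_adjoin_zeta_decompose:
  assumes d: "d > 0" and x: "x \<in> Z_adjoin (zeta d)"
  shows "\<exists>a\<in>Z_adjoin (tau (zeta d)). \<exists>b\<in>Z_adjoin (tau (zeta d)). x = a + zeta d * b"
proof -
  let ?z = "zeta d" and ?t = "tau (zeta d)"
  have "?z * inverse ?z = 1" by simp
  hence z2: "?z * ?z = (2 - ?t) * ?z - 1" by (simp add: tau_def algebra_simps)
  obtain A where A: "x = poly (of_int_poly A) ?z" using x by (rule Z_adjoinE)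
  have "\<exists>a\<in>Z_adjoin ?t. \<exists>b\<in>Z_adjoin ?t. poly (of_int_poly A) ?z = a + ?z * b"
  proof (induction A)
    case 0
    show ?case by (intro bexI[of _ 0]) auto
  next
    case (pCons c A)
    then obtain a b where ab: "a \<in> Z_adjoin ?t" "b \<in> Z_adjoin ?t" "poly (of_int_poly A) ?z = a + ?z * b"
      by blast
    have "poly (of_int_poly (pCons c A)) ?z = of_int c + ?z * a + (?z * ?z) * b"
      by (simp add: ab(3) algebra_simps)
    also have "\<dots> = (of_int c - b) + ?z * (a + (2 - ?t) * b)"
      unfolding z2 by (simp add: algebra_simps)
    finally show ?case using ab(1,2)
      by (metis Z_adjoin_add Z_adjoin_diff Z_adjoin_mult Z_adjoin_numeral Z_adjoin_of_int Z_adjoin_self)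
  qed
  thus ?thesis by (simp add: A)
qed

lemma Z_adjoin_zeta_Reals:
  assumes d: "d > 2" and x: "x \<in> Z_adjoin (zeta d)" "x \<in> \<real>"
  shows "x \<in> Z_adjoin (tau (zeta d))"
proof -
  obtain a b where ab: "a \<in> Z_adjoin (tau (zeta d))" "b \<in> Z_adjoin (tau (zeta d))" "x = a + zeta d * b"
    using Z_adjoin_zeta_decompose[of d x] d x(1) by auto
  have real: "a \<in> \<real>" "b \<in> \<real>" using ab(1,2) tau_zeta_real by (auto elim!: Z_adjoinE intro: Reals_poly_of_int)
  have "Im x = Im (zeta d) * Re b" using real by (simp add: ab(3) complex_is_Real_iff)
  hence "Re b = 0" using x(2) Im_zeta_nonzero[OF d] by (simp add: complex_is_Real_iff)
  hence "b = 0" using real by (simp add: complex_is_Real_iff complex_eq_iff)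
  thus ?thesis using ab by simp
qed

text \<open>An integer y of the field has a multiple D y in \<int>[\<tau>], so integral closedness
  puts y into \<int>[\<zeta>]; being real, it lies in \<int>[\<tau>].\<close>

lemma ring_of_integers_conjugate:
  assumes d: "d > 2" and x: "x \<in> conjugates d"
  shows "ring_of_integers (Q_adjoin {x}) = Z_adjoin x"
proof (intro equalityI subsetI)
  have d0: "d > 0" using d by simp
  fix y assume "y \<in> Z_adjoin x"
  thus "y \<in> ring_of_integers (Q_adjoin {x})"
    using Z_adjoin_subset_Q_adjoin algebraic_int_Z_adjoin_conjugate[OF d0 x]
    by (auto simp: ring_of_integers_def)
next
  let ?t = "tau (zeta d)"
  have d0: "d > 0" using d by simp
  fix y assume "y \<in> ring_of_integers (Q_adjoin {x})"
  hence y: "y \<in> Q_adjoin {?t}" "algebraic_int y"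
    by (auto simp: ring_of_integers_def Q_adjoin_conjugate[OF d0 x])
  obtain A where A: "y = poly (map_poly of_rat A) ?t"
    using y(1) Q_adjoin_conjugate_eq[OF d0 tau_zeta_in_conjugates] by auto
  obtain D B where DB: "D > 0"
    "\<And>x::complex. of_int D * poly (map_poly of_rat A) x = poly (of_int_poly B) x"
    using clear_denominators by blast
  have Dy: "of_int D * y = poly (of_int_poly B) ?t" using DB(2) by (simp add: A)
  have "of_nat (nat D) * y \<in> Z_adjoin (zeta d)"
    using Dy DB(1) Z_adjoin_poly[OF tau_zeta_in_Z_adjoin_zeta[OF d0]] by simp
  hence "y \<in> Z_adjoin (zeta d)"
    using DB(1) Z_adjoin_integrally_closed[OF zeta_power_self[OF d0] d0 y(2), of "nat D"] by simp
  moreover have "y \<in> \<real>"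
  proof -
    have "y = poly (of_int_poly B) ?t / of_int D" using Dy DB(1) by (simp add: field_simps)
    thus ?thesis using Reals_poly_of_int[OF tau_zeta_real] by auto
  qed
  ultimately have "y \<in> Z_adjoin ?t" using Z_adjoin_zeta_Reals[OF d] by blast
  thus "y \<in> Z_adjoin x" using Z_adjoin_conjugate[OF d0 x] by simp
qed

lemma complex_roots_Omega:
  assumes "odd d" "d > 1" "of_int_poly f = Omega d"
  shows "complex_roots f = conjugates d"
  using assms by (simp add: complex_roots_def poly_Omega_eq_0_iff)

text \<open>Independence of the powers of \<theta> is the degree bound \<open>Omega_minimal\<close>;
  they span \<int>[\<theta>] by division by the monic f.\<close>

theorem Omega_monogenic:
  assumes d: "odd d" "d > 1" and f: "of_int_poly f = Omega d"
  shows "monogenic f"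
  unfolding monogenic_def
proof (intro conjI ballI)
  show "monic_irreducible f" by (rule Omega_int_monic_irreducible[OF assms])
  hence lc: "lead_coeff f = 1" by (simp add: monic_irreducible_def)
  have deg: "degree f = totient d div 2"
    using degree_Omega[OF d] unfolding f[symmetric] by simp
  have d2: "d > 2" using d by (cases "d = 2") auto
  fix \<theta> assume "\<theta> \<in> complex_roots f"
  hence \<theta>: "\<theta> \<in> conjugates d" using complex_roots_Omega[OF assms] by simp
  have root: "poly (of_int_poly f) \<theta> = 0" using \<theta> by (simp add: f poly_Omega_eq_0_iff[OF d])
  show "is_Z_basis (degree f) (\<lambda>i. \<theta> ^ i) (ring_of_integers (Q_adjoin {\<theta>}))"
    unfolding is_Z_basis_def ring_of_integers_conjugate[OF d2 \<theta>]
  proof (intro conjI allI impI equalityI subsetI)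
    fix c :: "nat \<Rightarrow> int" and i
    assume eq: "(\<Sum>i<degree f. of_int (c i) * \<theta> ^ i) = 0" and i: "i < degree f"
    define h :: "rat poly" where "h = (\<Sum>i<degree f. monom (of_int (c i)) i)"
    have "poly (map_poly of_rat h) \<theta> = 0"
      using eq by (simp add: h_def of_rat_poly_hom.hom_sum poly_sum poly_monom)
    moreover have "degree h < totient d div 2"
    proof -
      have "degree h \<le> degree f - 1"
        unfolding h_def by (rule degree_sum_le) (auto intro: order.trans[OF degree_monom_le])
      thus ?thesis using i deg by simp
    qed
    ultimately have "h = 0" using Omega_minimal[OF d \<theta>] by force
    moreover have "coeff h i = of_int (c i)"
      using i by (simp add: h_def coeff_sum)
    ultimately show "c i = 0" by simp
  next
    fix y assume "y \<in> range (\<lambda>c. \<Sum>i<degree f. of_int (c i) * \<theta> ^ i)"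
    thus "y \<in> Z_adjoin \<theta>" by auto
  next
    fix y assume "y \<in> Z_adjoin \<theta>"
    then obtain A where A: "y = poly (of_int_poly A) \<theta>" by (rule Z_adjoinE)
    obtain q r where qr: "A = f * q + r" "r = 0 \<or> degree r < degree f"
      using monic_division[OF lc] by metis
    have "y = poly (of_int_poly r) \<theta>" using root by (simp add: A qr(1) hom_distribs)
    also have "\<dots> = (\<Sum>i<degree f. of_int (coeff r i) * \<theta> ^ i)"
    proof (cases "r = 0")
      case False
      hence "degree r < degree f" using qr(2) by simp
      hence "(\<Sum>i\<le>degree r. of_int (coeff r i) * \<theta> ^ i) = (\<Sum>i<degree f. of_int (coeff r i) * \<theta> ^ i)"
        by (intro sum.mono_neutral_left) (auto simp: coeff_eq_0)
      thus ?thesis by (simp add: poly_altdef)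
    qed simp
    finally show "y \<in> range (\<lambda>c. \<Sum>i<degree f. of_int (c i) * \<theta> ^ i)" by blast
  qed
qed

section \<open>The Galois group\<close>

abbreviation real_cyclotomic :: "nat \<Rightarrow> complex set" where
  "real_cyclotomic d \<equiv> Q_adjoin {tau (zeta d)}"

context
  fixes d :: nat
  assumes d: "odd d" "d > 1"
begin

text \<open>The automorphism induced by \<zeta> \<mapsto> \<zeta>^k. For k coprime to d the chosen
  polynomial does not matter, by \<open>conj_aut_poly\<close>. The restriction to the field makes
  the map extensional, as \<open>Bij\<close> demands.\<close>

definition conj_aut :: "nat \<Rightarrow> complex \<Rightarrow> complex" where
  "conj_aut k = (\<lambda>x\<in>real_cyclotomic d. poly (map_poly of_rat (SOME A. poly (map_poly of_rat A) (tau (zeta d)) = x)) (tau (zeta d ^ k)))"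

lemma K_cases:
  assumes "x \<in> real_cyclotomic d"
  obtains A where "x = poly (map_poly of_rat A) (tau (zeta d))"
  using assms Q_adjoin_conjugate_eq[OF _ tau_zeta_in_conjugates] d by auto

lemma poly_in_K: "poly (map_poly of_rat A) (tau (zeta d)) \<in> real_cyclotomic d"
  by (intro Q_adjoin_poly Q_adjoin_incl) simp

text \<open>Well-definedness: two polynomials with the same value at \<tau>(\<zeta>) also agree at
  every conjugate.\<close>

lemma conj_aut_poly:
  assumes "coprime k d"
  shows "conj_aut k (poly (map_poly of_rat A) (tau (zeta d))) = poly (map_poly of_rat A) (tau (zeta d ^ k))"
proof -
  define x where "x = poly (map_poly of_rat A) (tau (zeta d))"
  define B where "B = (SOME A. poly (map_poly of_rat A) (tau (zeta d)) = x)"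
  have "poly (map_poly of_rat B) (tau (zeta d)) = x"
    unfolding B_def by (rule someI[of _ A]) (simp add: x_def)
  hence "poly (map_poly of_rat (B - A)) (tau (zeta d)) = 0" by (simp add: x_def of_rat_poly_hom.hom_minus)
  moreover have "tau (zeta d ^ k) \<in> conjugates d" using assms by (auto simp: conjugates_def)
  ultimately have "poly (map_poly of_rat (B - A)) (tau (zeta d ^ k)) = 0"
    using conjugates_common_root[OF d tau_zeta_in_conjugates] by blast
  hence "poly (map_poly of_rat B) (tau (zeta d ^ k)) = poly (map_poly of_rat A) (tau (zeta d ^ k))"
    by (simp add: of_rat_poly_hom.hom_minus)
  thus ?thesis using poly_in_K[of A] by (simp add: conj_aut_def B_def x_def)
qed

lemma conj_aut_tau: "coprime k d \<Longrightarrow> conj_aut k (tau (zeta d)) = tau (zeta d ^ k)"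
  using conj_aut_poly[of k "[:0, 1:]"] by (simp add: of_rat_hom.map_poly_pCons_hom)

lemma conj_aut_in_K:
  assumes "coprime k d" "x \<in> real_cyclotomic d"
  shows "conj_aut k x \<in> real_cyclotomic d"
proof -
  obtain A where A: "x = poly (map_poly of_rat A) (tau (zeta d))" using assms(2) by (rule K_cases)
  have "tau (zeta d ^ k) \<in> Q_adjoin (conjugates d)"
    using assms(1) by (intro Q_adjoin_incl) (auto simp: conjugates_def)
  hence "tau (zeta d ^ k) \<in> real_cyclotomic d" using Q_adjoin_conjugates[of d] d by simp
  thus ?thesis unfolding A conj_aut_poly[OF assms(1)] by (rule Q_adjoin_poly)
qed

text \<open>Since \<tau>(u^l) = C(\<tau>(u)) for a fixed polynomial C, composing automorphisms
  amounts to composing polynomials.\<close>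

lemma conj_aut_mult:
  assumes "coprime k d" "coprime l d" "x \<in> real_cyclotomic d"
  shows "conj_aut k (conj_aut l x) = conj_aut (k * l) x"
proof -
  obtain A where A: "x = poly (map_poly of_rat A) (tau (zeta d))" using assms(3) by (rule K_cases)
  obtain C :: "int poly" where C: "\<And>u. u \<noteq> 0 \<Longrightarrow> tau (u ^ l) = poly (of_int_poly C) (tau u)"
    using tau_power by blast
  have C': "tau (u ^ l) = poly (map_poly of_rat (of_int_poly C)) (tau u)" if "u \<noteq> 0" for u
    unfolding of_rat_poly_of_int_poly by (rule C[OF that])
  have "conj_aut l x = poly (map_poly of_rat (A \<circ>\<^sub>p of_int_poly C)) (tau (zeta d))"
    unfolding A conj_aut_poly[OF assms(2)] C'[OF zeta_nonzero]
    by (simp add: of_rat_hom.map_poly_pcompose poly_pcompose)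
  hence "conj_aut k (conj_aut l x) = poly (map_poly of_rat (A \<circ>\<^sub>p of_int_poly C)) (tau (zeta d ^ k))"
    by (simp only: conj_aut_poly[OF assms(1)])
  also have "\<dots> = poly (map_poly of_rat A) (tau ((zeta d ^ k) ^ l))"
    using C'[of "zeta d ^ k"] by (simp add: of_rat_hom.map_poly_pcompose poly_pcompose)
  also have "\<dots> = conj_aut (k * l) x"
    unfolding A using assms conj_aut_poly[of "k * l"] by (simp add: power_mult)
  finally show ?thesis .
qed

lemma conj_aut_eqI:
  assumes "coprime k d" "coprime l d" "tau (zeta d ^ k) = tau (zeta d ^ l)"
  shows "conj_aut k = conj_aut l"
proof
  fix x
  show "conj_aut k x = conj_aut l x"
  proof (cases "x \<in> real_cyclotomic d")
    case True
    then obtain A where "x = poly (map_poly of_rat A) (tau (zeta d))" by (rule K_cases)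
    thus ?thesis using assms by (simp add: conj_aut_poly)
  qed (simp add: conj_aut_def)
qed

lemma conj_aut_1: "x \<in> real_cyclotomic d \<Longrightarrow> conj_aut 1 x = x"
  by (elim K_cases) (simp add: conj_aut_poly)

lemma conj_aut_Bij:
  assumes k: "coprime k d"
  shows "conj_aut k \<in> Bij (real_cyclotomic d)"
proof -
  obtain l where l: "coprime l d" "[k * l = 1] (mod d)" using inverse_mod[OF k] .
  have kl: "conj_aut (k * l) = conj_aut 1"
    using k l d tau_zeta_eq_iff[of d "k * l" 1] by (intro conj_aut_eqI) auto
  have "bij_betw (conj_aut k) (real_cyclotomic d) (real_cyclotomic d)"
  proof (rule bij_betw_byWitness[where f' = "conj_aut l"])
    show "\<forall>x\<in>real_cyclotomic d. conj_aut l (conj_aut k x) = x"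
      using conj_aut_mult[OF l(1) k] conj_aut_1 kl by (simp add: mult.commute)
    show "\<forall>x\<in>real_cyclotomic d. conj_aut k (conj_aut l x) = x"
      using conj_aut_mult[OF k l(1)] conj_aut_1 kl by simp
  qed (use conj_aut_in_K k l(1) in auto)
  moreover have "conj_aut k \<in> extensional (real_cyclotomic d)" by (simp add: conj_aut_def)
  ultimately show ?thesis by (simp add: Bij_def)
qed

context
  fixes f :: "int poly"
  assumes f: "of_int_poly f = Omega d"
begin

text \<open>An automorphism fixing \<rat> is determined by the image of \<tau>(\<zeta>), which is
  again a root of \<open>Omega d\<close> and hence some \<tau>(\<zeta>^k).\<close>

lemma carrier_Galois_group:
  "carrier (Galois_group f) = conj_aut ` {k. coprime k d}"
proof -
  let ?R = "(ring_of_type_algebra :: complex ring)\<lparr>carrier := real_cyclotomic d\<rparr>"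
  have car: "carrier (Galois_group f) = {\<sigma> \<in> Bij (real_cyclotomic d). \<sigma> \<in> Ring.ring_hom ?R ?R \<and> (\<forall>x\<in>\<rat>. \<sigma> x = x)}"
    unfolding Galois_group_def complex_roots_Omega[OF d f] using Q_adjoin_conjugates[of d] d
    by (simp add: Let_def)
  show ?thesis
    unfolding car
  proof (intro equalityI subsetI)
    fix \<sigma> assume "\<sigma> \<in> {\<sigma> \<in> Bij (real_cyclotomic d). \<sigma> \<in> Ring.ring_hom ?R ?R \<and> (\<forall>x\<in>\<rat>. \<sigma> x = x)}"
    hence \<sigma>: "\<sigma> \<in> Bij (real_cyclotomic d)" "\<sigma> \<in> Ring.ring_hom ?R ?R" "\<And>x. x \<in> \<rat> \<Longrightarrow> \<sigma> x = x" by auto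
    have add: "\<sigma> (x + y) = \<sigma> x + \<sigma> y" and mult: "\<sigma> (x * y) = \<sigma> x * \<sigma> y" if "x \<in> real_cyclotomic d" "y \<in> real_cyclotomic d" for x y
      using ring_hom_add[OF \<sigma>(2), of x y] ring_hom_mult[OF \<sigma>(2), of x y] that by auto
    have tK: "(tau (zeta d)) \<in> real_cyclotomic d" by (rule Q_adjoin_incl) simp
    have poly: "\<sigma> (poly (map_poly of_rat A) (tau (zeta d))) = poly (map_poly of_rat A) (\<sigma> (tau (zeta d)))" for A
    proof (induction A)
      case 0
      show ?case using \<sigma>(3)[of 0] by simp
    next
      case (pCons a A)
      have "\<sigma> (of_rat a + tau (zeta d) * poly (map_poly of_rat A) (tau (zeta d))) =
        \<sigma> (of_rat a) + \<sigma> (tau (zeta d)) * \<sigma> (poly (map_poly of_rat A) (tau (zeta d)))"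
        using add[OF Q_adjoin_of_rat Q_adjoin_mult[OF tK poly_in_K]] mult[OF tK poly_in_K] by simp
      also have "\<dots> = of_rat a + \<sigma> (tau (zeta d)) * poly (map_poly of_rat A) (\<sigma> (tau (zeta d)))"
        using pCons.IH \<sigma>(3)[of "of_rat a"] by simp
      finally have "\<sigma> (of_rat a + tau (zeta d) * poly (map_poly of_rat A) (tau (zeta d))) =
        of_rat a + \<sigma> (tau (zeta d)) * poly (map_poly of_rat A) (\<sigma> (tau (zeta d)))" .
      thus ?case by (simp add: of_rat_hom.map_poly_pCons_hom)
    qed
    have "poly (Omega d) (\<sigma> (tau (zeta d))) = \<sigma> (poly (Omega d) (tau (zeta d)))"
      unfolding f[symmetric] of_rat_poly_of_int_poly[symmetric] by (rule poly[symmetric])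
    also have "poly (Omega d) (tau (zeta d)) = 0"
      using tau_zeta_in_conjugates by (simp add: poly_Omega_eq_0_iff[OF d])
    also have "\<sigma> 0 = 0" using \<sigma>(3)[of 0] by simp
    finally have "\<sigma> (tau (zeta d)) \<in> conjugates d" by (simp add: poly_Omega_eq_0_iff[OF d])
    then obtain k where k: "coprime k d" "\<sigma> (tau (zeta d)) = tau (zeta d ^ k)" by (auto simp: conjugates_def)
    have "\<sigma> = conj_aut k"
    proof
      fix x
      show "\<sigma> x = conj_aut k x"
      proof (cases "x \<in> real_cyclotomic d")
        case True
        then obtain A where "x = poly (map_poly of_rat A) (tau (zeta d))" by (rule K_cases)
        thus ?thesis using poly k by (simp add: conj_aut_poly)
      next
        \<comment> \<open>Outside the field both maps take the default value of extensional
          functions.\<close>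
        case False
        show ?thesis
          using extensional_arb[OF Bij_imp_extensional[OF \<sigma>(1)] False]
            extensional_arb[OF Bij_imp_extensional[OF conj_aut_Bij[OF k(1)]] False]
          by (rule trans[OF _ sym])
      qed
    qed
    thus "\<sigma> \<in> conj_aut ` {k. coprime k d}" using k(1) by blast
  next
    fix \<sigma> assume "\<sigma> \<in> conj_aut ` {k. coprime k d}"
    then obtain k where k: "coprime k d" "\<sigma> = conj_aut k" by blast
    have "conj_aut k \<in> Ring.ring_hom ?R ?R"
    proof (rule ring_hom_memI)
      fix x assume "x \<in> carrier ?R"
      thus "conj_aut k x \<in> carrier ?R" using conj_aut_in_K[OF k(1)] by simp
    next
      fix x y assume "x \<in> carrier ?R" "y \<in> carrier ?R"
      then obtain A B where AB: "x = poly (map_poly of_rat A) (tau (zeta d))" "y = poly (map_poly of_rat B) (tau (zeta d))"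
        by (auto elim!: K_cases)
      show "conj_aut k (x \<otimes>\<^bsub>?R\<^esub> y) = conj_aut k x \<otimes>\<^bsub>?R\<^esub> conj_aut k y"
        using conj_aut_poly[OF k(1), of "A * B"]
        by (simp add: AB conj_aut_poly[OF k(1)] of_rat_poly_hom.hom_mult)
      show "conj_aut k (x \<oplus>\<^bsub>?R\<^esub> y) = conj_aut k x \<oplus>\<^bsub>?R\<^esub> conj_aut k y"
        using conj_aut_poly[OF k(1), of "A + B"]
        by (simp add: AB conj_aut_poly[OF k(1)] of_rat_poly_hom.hom_add)
    next
      show "conj_aut k \<one>\<^bsub>?R\<^esub> = \<one>\<^bsub>?R\<^esub>"
        using conj_aut_poly[OF k(1), of 1] by simp
    qed
    moreover have "conj_aut k x = x" if x: "x \<in> \<rat>" for x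
    proof -
      obtain q where "x = of_rat q" using x by (rule Rats_cases)
      thus ?thesis using conj_aut_poly[OF k(1), of "[:q:]"] by (simp add: of_rat_hom.map_poly_pCons_hom)
    qed
    ultimately show "\<sigma> \<in> {\<sigma> \<in> Bij (real_cyclotomic d). \<sigma> \<in> Ring.ring_hom ?R ?R \<and> (\<forall>x\<in>\<rat>. \<sigma> x = x)}"
      using conj_aut_Bij[OF k(1)] k(2) by blast
  qed
qed

lemma mult_Galois_group:
  assumes "coprime k d" "coprime l d"
  shows "conj_aut k \<otimes>\<^bsub>Galois_group f\<^esub> conj_aut l = conj_aut (k * l)"
proof -
  have "conj_aut k \<otimes>\<^bsub>Galois_group f\<^esub> conj_aut l = compose (real_cyclotomic d) (conj_aut k) (conj_aut l)"
    unfolding Galois_group_def complex_roots_Omega[OF d f] using Q_adjoin_conjugates[of d] d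
      conj_aut_Bij[OF assms(1)] conj_aut_Bij[OF assms(2)]
    by (simp add: Let_def BijGroup_def)
  also have "\<dots> = conj_aut (k * l)"
  proof
    fix x
    show "compose (real_cyclotomic d) (conj_aut k) (conj_aut l) x = conj_aut (k * l) x"
      using conj_aut_mult[OF assms, of x] by (cases "x \<in> real_cyclotomic d") (simp_all add: compose_def, simp add: conj_aut_def)
  qed
  finally show ?thesis .
qed

text \<open>The m values \<tau>(\<zeta>^(g^i)) with i < m are distinct by the choice of g, hence
  they are all the conjugates. Once period m is established, i \<mapsto>
  \<open>conj_aut (g ^ i)\<close> is an isomorphism from the integers modulo m.\<close>

theorem Omega_cyclic:
  assumes g: "generates_mod_sign d g"
  shows "cyclic_poly f"
proof -
  define m where "m = totient d div 2"
  have d0: "d > 0" using d by simp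
  have deg: "degree f = m"
    using degree_Omega[OF d] unfolding f[symmetric] by (simp add: m_def)
  have "card (conjugates d) > 0"
    using tau_zeta_in_conjugates finite_conjugates[OF d] by (auto simp: card_gt_0_iff)
  hence m: "m > 0" using card_conjugates[OF d] by (simp add: m_def)
  have co: "coprime g d" using g by (simp add: generates_mod_sign_def)
  hence cog: "coprime (g ^ i) d" for i by simp
  \<comment> \<open>Equal values mean g^i and g^j agree modulo d up to sign; cancelling g^i leaves a
    power of g that is 1 or -1.\<close>
  have sign: "m dvd j - i" if "i \<le> j" "tau (zeta d ^ g ^ i) = tau (zeta d ^ g ^ j)" for i j
  proof -
    have pow: "int g ^ j = int g ^ i * int g ^ (j - i)" using that(1) by (simp flip: power_add)
    have cop: "coprime (int g ^ i) (int d)" using co by simp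
    from that(2) have "[g ^ i = g ^ j] (mod d) \<or> d dvd g ^ i + g ^ j"
      by (simp only: tau_zeta_eq_iff[OF d0])
    hence "\<exists>\<epsilon>\<in>{1, -1}. [int g ^ (j - i) = \<epsilon>] (mod int d)"
    proof
      assume "[g ^ i = g ^ j] (mod d)"
      hence "[int (g ^ j) = int (g ^ i)] (mod int d)" unfolding cong_int_iff by (rule cong_sym)
      hence "[int g ^ i * int g ^ (j - i) = int g ^ i * 1] (mod int d)" by (simp add: pow)
      thus ?thesis using cop by (simp only: cong_mult_lcancel) simp
    next
      assume "d dvd g ^ i + g ^ j"
      hence "int d dvd int (g ^ i + g ^ j)" by (simp only: int_dvd_int_iff)
      hence "int d dvd int g ^ i * int g ^ (j - i) - int g ^ i * (-1)"
        by (simp add: pow add.commute)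
      hence "[int g ^ i * int g ^ (j - i) = int g ^ i * (-1)] (mod int d)"
        by (simp only: cong_iff_dvd_diff)
      hence "[int g ^ (j - i) = -1] (mod int d)" using cop by (simp only: cong_mult_lcancel)
      thus ?thesis by blast
    qed
    thus ?thesis using g unfolding generates_mod_sign_def m_def by blast
  qed
  have inj: "inj_on (\<lambda>i. tau (zeta d ^ g ^ i)) {..<m}"
  proof (rule linorder_inj_onI)
    fix i j assume ij: "i < j" "i \<in> {..<m}" "j \<in> {..<m}"
    show "tau (zeta d ^ g ^ i) \<noteq> tau (zeta d ^ g ^ j)"
    proof
      assume "tau (zeta d ^ g ^ i) = tau (zeta d ^ g ^ j)"
      hence "m dvd j - i" using sign ij(1) by simp
      hence "m \<le> j - i" using ij(1) by (intro dvd_imp_le) auto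
      thus False using ij by simp
    qed
  qed (use nat_le_linear in blast)
  have sub: "(\<lambda>i. tau (zeta d ^ g ^ i)) ` {..<m} \<subseteq> conjugates d"
    using cog by (auto simp: conjugates_def)
  have surj: "(\<lambda>i. tau (zeta d ^ g ^ i)) ` {..<m} = conjugates d"
  proof (rule card_subset_eq[OF finite_conjugates[OF d] sub])
    have "card ((\<lambda>i. tau (zeta d ^ g ^ i)) ` {..<m}) = m"
      by (simp only: card_image[OF inj] card_lessThan)
    thus "card ((\<lambda>i. tau (zeta d ^ g ^ i)) ` {..<m}) = card (conjugates d)"
      by (simp only: card_conjugates[OF d] m_def)
  qed
  \<comment> \<open>The m-th value must repeat some i-th with i < m, and then m divides m - i, so i
    = 0.\<close>
  have "tau (zeta d ^ g ^ m) \<in> conjugates d" using cog by (auto simp: conjugates_def)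
  hence "tau (zeta d ^ g ^ m) \<in> (\<lambda>i. tau (zeta d ^ g ^ i)) ` {..<m}" unfolding surj .
  then obtain i where i: "i < m" "tau (zeta d ^ g ^ m) = tau (zeta d ^ g ^ i)" by blast
  have "m dvd m - i" using sign[OF less_imp_le[OF i(1)] i(2)[symmetric]] .
  hence "m \<le> m - i" using i(1) by (intro dvd_imp_le) auto
  hence "i = 0" using i(1) by simp
  hence one: "conj_aut (g ^ m) = conj_aut 1" using i(2) by (intro conj_aut_eqI cog) auto
  have shift: "conj_aut (g ^ (m + j)) = conj_aut (g ^ j)" for j
  proof -
    have "conj_aut (g ^ (m + j)) = conj_aut (g ^ m) \<otimes>\<^bsub>Galois_group f\<^esub> conj_aut (g ^ j)"
      by (simp only: mult_Galois_group[OF cog cog] power_add)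
    also have "\<dots> = conj_aut (g ^ j)"
      unfolding one mult_Galois_group[OF coprime_1_left cog] by simp
    finally show ?thesis .
  qed
  have period: "conj_aut (g ^ (j mod m)) = conj_aut (g ^ j)" for j
  proof (induction j rule: less_induct)
    case (less j)
    show ?case
    proof (cases "j < m")
      case False
      have "conj_aut (g ^ (j mod m)) = conj_aut (g ^ ((j - m) mod m))"
        using False by (simp add: le_mod_geq)
      also have "\<dots> = conj_aut (g ^ (j - m))" using less.IH[of "j - m"] m False by simp
      also have "\<dots> = conj_aut (g ^ j)" using shift[of "j - m"] False by simp
      finally show ?thesis .
    qed simp
  qed
  define h where "h = (\<lambda>i::int. conj_aut (g ^ nat i))"
  have "h \<in> iso (integer_mod_group m) (Galois_group f)"
  proof (rule isoI)
    show "h \<in> hom (integer_mod_group m) (Galois_group f)"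
    proof (rule homI)
      fix x assume "x \<in> carrier (integer_mod_group m)"
      show "h x \<in> carrier (Galois_group f)"
        unfolding carrier_Galois_group h_def using cog by blast
      fix y assume "y \<in> carrier (integer_mod_group m)"
      hence xy: "x \<ge> 0" "y \<ge> 0" using \<open>x \<in> _\<close> m by (auto simp: carrier_integer_mod_group)
      have "nat ((x + y) mod int m) = (nat x + nat y) mod m"
        using xy by (simp add: nat_mod_distrib nat_add_distrib)
      thus "h (x \<otimes>\<^bsub>integer_mod_group m\<^esub> y) = h x \<otimes>\<^bsub>Galois_group f\<^esub> h y"
        using period by (simp add: h_def mult_Galois_group[OF cog cog] power_add)
    qed
    have car: "carrier (integer_mod_group m) = int ` {..<m}"
      using m by (auto simp: carrier_integer_mod_group image_iff intro!: bexI[of _ "nat _"])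
    show "bij_betw h (carrier (integer_mod_group m)) (carrier (Galois_group f))"
      unfolding bij_betw_def
    proof
      show "inj_on h (carrier (integer_mod_group m))"
        unfolding car
      proof (rule inj_onI)
        fix x y assume xy: "x \<in> int ` {..<m}" "y \<in> int ` {..<m}" "h x = h y"
        hence "h x (tau (zeta d)) = h y (tau (zeta d))" by simp
        hence "tau (zeta d ^ g ^ nat x) = tau (zeta d ^ g ^ nat y)"
          by (simp add: h_def conj_aut_tau[OF cog])
        hence "nat x = nat y" using inj_onD[OF inj] xy(1,2) by auto
        thus "x = y" using xy(1,2) by auto
      qed
      show "h ` carrier (integer_mod_group m) = carrier (Galois_group f)"
        unfolding car carrier_Galois_group
      proof (intro equalityI subsetI)
        fix \<sigma> assume "\<sigma> \<in> conj_aut ` {k. coprime k d}"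
        then obtain k where k: "coprime k d" "\<sigma> = conj_aut k" by blast
        hence "tau (zeta d ^ k) \<in> conjugates d" by (auto simp: conjugates_def)
        then obtain j where j: "j < m" "tau (zeta d ^ k) = tau (zeta d ^ g ^ j)"
          unfolding surj[symmetric] by blast
        hence "\<sigma> = h (int j)" unfolding k(2) h_def by (simp add: conj_aut_eqI[OF k(1) cog])
        thus "\<sigma> \<in> h ` int ` {..<m}" using j(1) by blast
      qed (use cog in \<open>auto simp: h_def\<close>)
    qed
  qed
  hence "integer_mod_group m \<cong> Galois_group f" by (auto simp: is_iso_def)
  hence "Galois_group f \<cong> integer_mod_group m" by (rule group.iso_sym[OF group_integer_mod_group])
  thus ?thesis using Omega_int_monic_irreducible[OF d f] deg by (simp add: cyclic_poly_def)
qed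

end

end

section \<open>Distinctness of the fields\<close>

text \<open>Both roots of unity are powers of Z of order d1 d2, so a relation \<tau>(\<zeta>_2) =
  A(\<tau>(\<zeta>_1)) is a polynomial relation at \<tau>(Z) and survives Z \<mapsto> Z^k. As this
  fixes \<zeta>_1, it fixes \<tau>(\<zeta>_2).\<close>

lemma Q_adjoin_conjugate_eq_imp:
  assumes d: "d1 > 0" "d2 > 0"
    and eq: "Q_adjoin {tau (zeta d1)} = Q_adjoin {tau (zeta d2)}"
    and k: "coprime k (d1 * d2)" "[k = 1] (mod d1)"
  shows "[k = 1] (mod d2) \<or> d2 dvd k + 1"
proof -
  define Z where "Z = zeta (d1 * d2)"
  have Z: "Z ^ (d1 * d2) = 1" "Z \<noteq> 0" using d by (simp_all add: Z_def zeta_power_self)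
  have Z1: "Z ^ d2 = zeta d1" and Z2: "Z ^ d1 = zeta d2"
    using d by (simp_all add: Z_def zeta_def DeMoivre)
  have "tau (zeta d2) \<in> Q_adjoin {tau (zeta d1)}" unfolding eq by (rule Q_adjoin_incl) simp
  then obtain A where A: "tau (zeta d2) = poly (map_poly of_rat A) (tau (zeta d1))"
    using Q_adjoin_conjugate_eq[OF d(1) tau_zeta_in_conjugates] by auto
  obtain C1 :: "int poly" where "\<And>u. u \<noteq> 0 \<Longrightarrow> tau (u ^ d2) = poly (of_int_poly C1) (tau u)"
    using tau_power by blast
  hence C1: "\<And>u. u \<noteq> 0 \<Longrightarrow> tau (u ^ d2) = poly (map_poly of_rat (of_int_poly C1)) (tau u)"
    unfolding of_rat_poly_of_int_poly .
  obtain C2 :: "int poly" where "\<And>u. u \<noteq> 0 \<Longrightarrow> tau (u ^ d1) = poly (of_int_poly C2) (tau u)"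
    using tau_power by blast
  hence C2: "\<And>u. u \<noteq> 0 \<Longrightarrow> tau (u ^ d1) = poly (map_poly of_rat (of_int_poly C2)) (tau u)"
    unfolding of_rat_poly_of_int_poly .
  define h where "h = A \<circ>\<^sub>p of_int_poly C1 - of_int_poly C2"
  have h: "poly (map_poly of_rat h) (tau u) = poly (map_poly of_rat A) (tau (u ^ d2)) - tau (u ^ d1)"
    if "u \<noteq> 0" for u
    unfolding C1[OF that] C2[OF that] h_def of_rat_poly_hom.hom_minus
    by (simp add: of_rat_hom.map_poly_pcompose poly_pcompose)
  have "poly (map_poly of_rat h) (tau Z) = 0" using h[OF Z(2)] A by (simp add: Z1 Z2)
  hence "poly (map_poly of_rat h) (tau (Z ^ k)) = 0"
    using d by (intro tau_conjugate[OF Z(1) _ k(1)]) simp_all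
  hence "tau ((Z ^ k) ^ d1) = poly (map_poly of_rat A) (tau ((Z ^ k) ^ d2))"
    using h[of "Z ^ k"] Z(2) by simp
  moreover have "(Z ^ k) ^ d1 = zeta d2 ^ k" "(Z ^ k) ^ d2 = zeta d1 ^ k"
    by (simp_all add: mult.commute flip: Z1 Z2 power_mult)
  moreover have "zeta d1 ^ k = zeta d1"
    using zeta_power_eq_iff[OF d(1), of k 1] k(2) by simp
  ultimately have "tau (zeta d2 ^ k) = tau (zeta d2 ^ 1)" using A by simp
  thus ?thesis unfolding tau_zeta_eq_iff[OF d(2)] .
qed

text \<open>Take k = 2 modulo the p-part p^b of d2 and k = 1 modulo d1 and the cofactor e. Then k is
  not 1 modulo d2, so d2 divides k + 1; hence p^b divides 3 and the odd e divides 2.\<close>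

lemma Q_adjoin_conjugate_coprime_prime:
  assumes d: "odd d1" "odd d2" "d1 > 1" "d2 > 1"
    and eq: "Q_adjoin {tau (zeta d1)} = Q_adjoin {tau (zeta d2)}"
    and p: "prime p" "p dvd d2" "\<not> p dvd d1"
  shows "d2 = 3"
proof -
  obtain b e where be: "d2 = p ^ b * e" "\<not> p dvd e" "b > 0"
  proof -
    obtain e where "d2 = p ^ multiplicity p d2 * e" "\<not> p dvd e"
      using multiplicity_decompose'[of d2 p] d p not_prime_unit by auto
    moreover have "multiplicity p d2 > 0" using p d by (simp add: prime_multiplicity_gt_zero_iff)
    ultimately show ?thesis using that by blast
  qed
  have "odd (p ^ b)" using d(2) be(1) by auto
  have co: "coprime (p ^ b) (d1 * e)"
    using p be by (simp add: prime_imp_coprime)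
  obtain k where k: "[k = 2] (mod p ^ b)" "[k = 1] (mod d1 * e)"
    using binary_chinese_remainder_nat[OF co] by blast
  have "coprime k (p ^ b)"
    using \<open>odd (p ^ b)\<close> cong_imp_coprime[OF cong_sym[OF k(1)]] by (simp add: coprime_left_2_iff_odd)
  moreover have "coprime k (d1 * e)" using cong_imp_coprime[OF cong_sym[OF k(2)]] by simp
  ultimately have "coprime k (d1 * d2)" unfolding be(1) by simp
  moreover have "[k = 1] (mod d1)" using k(2) by (rule cong_dvd_modulus_nat) simp
  ultimately have "[k = 1] (mod d2) \<or> d2 dvd k + 1"
    using Q_adjoin_conjugate_eq_imp[OF _ _ eq] d by auto
  moreover have "\<not> [k = 1] (mod d2)"
  proof
    assume "[k = 1] (mod d2)"
    hence "[k = 1] (mod p ^ b)" by (rule cong_dvd_modulus_nat) (simp add: be(1))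
    hence "[2 = 1] (mod p ^ b)" using k(1) cong_trans cong_sym by blast
    hence "p ^ b = 1" using cong_altdef_nat[of 1 2 "p ^ b"] by simp
    thus False using be(3) p(1) by auto
  qed
  ultimately have dvd: "d2 dvd k + 1" by blast
  have "[k + 1 = 2 + 1] (mod p ^ b)" using k(1) by (intro cong_add) auto
  moreover have "p ^ b dvd k + 1" using dvd be(1) by (meson dvd_trans dvd_triv_left)
  ultimately have "p ^ b dvd 3" by (simp add: cong_dvd_iff)
  moreover have "p ^ b \<noteq> 1" using be(3) p(1) by auto
  moreover have "prime (3::nat)" by simp
  ultimately have pb: "p ^ b = 3" by (meson prime_nat_iff)
  have "[k = 1] (mod e)" using k(2) by (rule cong_dvd_modulus_nat) simp
  hence "[k + 1 = 1 + 1] (mod e)" by (intro cong_add) auto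
  moreover have "e dvd k + 1" using dvd be(1) by (meson dvd_trans dvd_triv_right)
  ultimately have "e dvd 2" by (metis cong_dvd_iff one_add_one)
  moreover have "odd e" using d(2) be(1) by auto
  ultimately have "e = 1" by (metis prime_nat_iff two_is_prime_nat dvd_refl)
  thus ?thesis using be(1) pb by simp
qed

text \<open>Otherwise every prime of d2 divides d1, so k = 1 + d1 is a unit modulo d1 d2. As d2 does
  not divide d1, it must divide d1 + 2, and a prime of d2 would divide 2. The value 3, whose field
  is \<rat>, is settled by symmetry in \<open>Omega_distinct\<close>.\<close>

lemma Q_adjoin_conjugate_dvd:
  assumes d: "odd d1" "odd d2" "d1 > 1" "d2 > 1"
    and eq: "Q_adjoin {tau (zeta d1)} = Q_adjoin {tau (zeta d2)}"
  shows "d2 dvd d1 \<or> d2 = 3"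
proof (rule ccontr)
  assume "\<not> ?thesis"
  hence nd: "\<not> d2 dvd d1" "d2 \<noteq> 3" by auto
  have primes: "p dvd d1" if "prime p" "p dvd d2" for p
    using Q_adjoin_conjugate_coprime_prime[OF d eq that] nd(2) by blast
  have "coprime (1 + d1) d2"
  proof (rule ccontr)
    assume "\<not> coprime (1 + d1) d2"
    then obtain p where "prime p" "p dvd gcd (1 + d1) d2"
      using prime_factor_nat[of "gcd (1 + d1) d2"] by (auto simp: coprime_iff_gcd_eq_1)
    hence p: "prime p" "p dvd 1 + d1" "p dvd d1" using primes by auto
    hence "p dvd 1" using dvd_add_left_iff by blast
    thus False using p(1) by simp
  qed
  moreover have "coprime (1 + d1) d1" using coprime_Suc_left_nat[of d1] by simp
  ultimately have "coprime (1 + d1) (d1 * d2)" by simp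
  moreover have "[1 + d1 = 1] (mod d1)" using cong_altdef_nat[of 1 "1 + d1" d1] by simp
  ultimately have "[1 + d1 = 1] (mod d2) \<or> d2 dvd 1 + d1 + 1"
    using Q_adjoin_conjugate_eq_imp[OF _ _ eq] d by auto
  moreover have "\<not> [1 + d1 = 1] (mod d2)" using nd(1) cong_altdef_nat[of 1 "1 + d1" d2] by simp
  ultimately have dvd: "d2 dvd d1 + 2" by simp
  obtain p where p: "prime p" "p dvd d2" using prime_factor_nat[of d2] d(4) by auto
  have "p dvd d1 + 2" using p(2) dvd by (rule dvd_trans)
  hence "p dvd 2" using primes[OF p] dvd_add_right_iff by blast
  hence "p = 2" using p(1) by (simp add: primes_dvd_imp_eq)
  thus False using p(2) d(2) by simp
qed

theorem Omega_distinct: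
  assumes d: "odd d1" "odd d2" "d1 > 1" "d2 > 1" "d1 \<noteq> d2"
    and f: "of_int_poly f1 = Omega d1" "of_int_poly f2 = Omega d2"
  shows "distinct_polys f1 f2"
proof
  assume "equivalent f1 f2"
  then obtain \<alpha> \<beta> where "\<alpha> \<in> conjugates d1" "\<beta> \<in> conjugates d2" "Q_adjoin {\<alpha>} = Q_adjoin {\<beta>}"
    unfolding equivalent_def
    using complex_roots_Omega[OF d(1,3) f(1)] complex_roots_Omega[OF d(2,4) f(2)] by auto
  hence eq: "Q_adjoin {tau (zeta d1)} = Q_adjoin {tau (zeta d2)}"
    using Q_adjoin_conjugate[of d1 \<alpha>] Q_adjoin_conjugate[of d2 \<beta>] d(3,4) by simp
  have "d2 dvd d1 \<or> d2 = 3" "d1 dvd d2 \<or> d1 = 3"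
    using Q_adjoin_conjugate_dvd[OF d(1-4) eq] Q_adjoin_conjugate_dvd[OF d(2,1,4,3) eq[symmetric]] by auto
  \<comment> \<open>If one of d1 and d2 is 3, the other divides 3 or equals it; otherwise each
    divides the other.\<close>
  moreover have "m = 3" if "m dvd 3" "m > 1" for m :: nat
    using that prime_nat_iff[of 3] by auto
  ultimately show False using d(3-5) dvd_antisym by blast
qed

text \<open>As \<open>map_poly of_int\<close> is injective, the integer polynomials are determined
  by \<open>Omega\<close>, and the existential quantifiers merely name them.\<close>

theorem corollary1p5:
  shows
    "(\<forall>n. map_poly of_rat ` {g :: rat poly. lead_coeff g = 1 \<and> irreducible g \<and> g dvd map_poly of_int (w n)}
          = Omega ` {d. d > 1 \<and> int d dvd 2 * int n - 1}) \<and>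
     (\<forall>n\<ge>2. condition_C (2 * n - 1) \<longrightarrow>
        (\<forall>d. d > 1 \<and> d dvd 2 * n - 1 \<longrightarrow>
          (\<exists>f. map_poly of_int f = Omega d \<and> monogenic f \<and> cyclic_poly f))) \<and>
     (\<forall>n1\<ge>2. \<forall>n2\<ge>2. \<forall>d1 d2. d1 = 2 * n1 - 1 \<and> d2 = 2 * n2 - 1 \<and>
          condition_C d1 \<and> condition_C d2 \<and> d1 \<noteq> d2 \<longrightarrow>
        (\<exists>f1 f2. map_poly of_int f1 = Omega d1 \<and> map_poly of_int f2 = Omega d2 \<and> distinct_polys f1 f2))"
proof (intro conjI allI impI)
  fix n
  show "map_poly of_rat ` {g :: rat poly. lead_coeff g = 1 \<and> irreducible g \<and> g dvd map_poly of_int (w n)}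
          = Omega ` {d. d > 1 \<and> int d dvd 2 * int n - 1}"
    by (rule irreducible_factors_w)
next
  fix n d :: nat
  assume n: "2 \<le> n" "condition_C (2 * n - 1)" and d: "d > 1 \<and> d dvd 2 * n - 1"
  have odd: "odd (2 * n - 1)" using n(1) by simp
  hence d': "odd d" "d > 1" using d dvd_trans by blast+
  obtain f :: "int poly" where f: "of_int_poly f = Omega d" using Omega_integral[OF d'] .
  obtain g where "generates_mod_sign d g"
    using condition_C_generates_mod_sign[OF n(2) odd] d by blast
  thus "\<exists>f. map_poly of_int f = Omega d \<and> monogenic f \<and> cyclic_poly f"
    using f Omega_monogenic[OF d' f] Omega_cyclic[OF d' f] by blast
next
  fix n1 n2 d1 d2 :: nat
  assume n: "2 \<le> n1" "2 \<le> n2" and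
    d: "d1 = 2 * n1 - 1 \<and> d2 = 2 * n2 - 1 \<and> condition_C d1 \<and> condition_C d2 \<and> d1 \<noteq> d2"
  hence odd: "odd d1" "odd d2" and gt: "d1 > 1" "d2 > 1" by auto
  obtain f1 f2 :: "int poly" where "of_int_poly f1 = Omega d1" "of_int_poly f2 = Omega d2"
    using Omega_integral[OF odd(1) gt(1)] Omega_integral[OF odd(2) gt(2)] by metis
  thus "\<exists>f1 f2. map_poly of_int f1 = Omega d1 \<and> map_poly of_int f2 = Omega d2 \<and> distinct_polys f1 f2"
    using Omega_distinct[OF odd gt] d by blast
qed

end
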